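(* Let $\mathbb{K}$ be an algebraically closed field of characteristic zero, and let $(\mathcal{M}_f)$ be the radical-rational dynamical system of dimension $M$ associated with $N\geq 1$ irreducible difference polynomials $p_1,\ldots,p_N$ over $\mathbb{K}$ and a rational function $f\in\mathbb{K}(X_1,\ldots,X_N)$, with associated polynomial data $Q,\mu,\mathbf{a},\mathbf{e}_{\mathbf{a}},b$ (see context). On the commutative ring $\mathbb{K}[\sigma^{\infty}(\mathbf{w}),\sigma^{\infty}(z)]$, seen as a polynomial ring in the infinitely many variables $\sigma^j(w_i)$, $\sigma^j(z)$ ($1\le i\le M$, $j\in\mathbb{N}$), consider the lexicographic monomial ordering corresponding to any ordering on the variables such that (i) $\sigma^{j_1}(z)\succ\sigma^{j_2}(w_i)$ for all $i$ and all $j_1,j_2\in\mathbb{N}$; (ii) $\sigma^{j+1}(z)\succ\sigma^j(z)$ and $\sigma^{j+1}(w_{i_1})\succ\sigma^j(w_{i_2})$ for all $i_1,i_2$ and all $j\in\mathbb{N}$. Then the set $\mathcal{E}=\{Q\,\sigma(\mathbf{w})^{\mu}-\mathbf{a}(\mathbf{w})-\mathbf{e}_{\mathbf{a}}(\sigma(\mathbf{w})),\; Qz-b(\mathbf{w})\}$ is a triangular set with respect to this ordering. Moreover, $$\langle\sigma^{\le M}(I_{\mathcal{M}_f})\rangle\cap\mathbb{K}[\sigma^{\infty}(z)]\neq\langle 0\rangle.$$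
   Context: For $i=1,\ldots,N$ let $p_i\in\mathbb{K}[s_i,\sigma(s_i),\sigma^2(s_i),\ldots]$ be an irreducible difference polynomial of order $n_i\ge 1$ (the largest $j$ such that $\sigma^j(s_i)$ occurs), let $m_i$ be its degree in $\sigma^{n_i}(s_i)$, and let $\mathcal{I}_{p_i}$ be its initial, i.e. its leading coefficient as a polynomial in $\sigma^{n_i}(s_i)$. Put $M_0=0$, $M_i=n_1+\cdots+n_i$, $M=M_N$. Introduce indeterminates $\mathbf{w}=(w_1,\ldots,w_M)$, where $w_{M_{i-1}+k}$ stands for $\sigma^{k-1}(s_i)$, $1\le k\le n_i$, $1\le i\le N$. In these variables $$p_i=\mathcal{I}_{p_i}\,\sigma(w_{M_i})^{m_i}+p_{i,1}\bigl(w_{M_{i-1}+1},\ldots,w_{M_i},\sigma(w_{M_i})\bigr),$$ with $p_{i,1}$ of degree less than $m_i$ in $\sigma(w_{M_i})$ and $\mathcal{I}_{p_i}$ a polynomial in $w_{M_{i-1}+1},\ldots,w_{M_i}$. The system $(\mathcal{M}_f)$ consists of the equations $$\sigma(w_k)^{\mu_k}=A_k(\mathbf{w})+E_{A_k}(\sigma(w_k)),\quad k=1,\ldots,M,\qquad z=B(\mathbf{w}),$$ where: - if $k\notin\{M_1,\ldots,M_N\}$, then $\mu_k=1$, $A_k=w_{k+1}$, $E_{A_k}=0$; - if $k=M_i$, then $\mu_k=m_i$ and $A_k+E_{A_k}=-p_{i,1}/\mathcal{I}_{p_i}$, with $A_k$ the part free of $\sigma(w_k)$ and $E_{A_k}$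 the part containing $\sigma(w_k)$ (its coefficients may involve $\mathbf{w}$); - $B(\mathbf{w})=f(w_{M_0+1},w_{M_1+1},\ldots,w_{M_{N-1}+1})$. $Q\in\mathbb{K}[\mathbf{w}]$ is the common denominator of all these expressions, and one writes $A_k=a_k/Q$, $E_{A_k}=e_{a_k}/Q$, $B=b/Q$. The displayed vector notation $Q\,\sigma(\mathbf{w})^{\mu}-\mathbf{a}(\mathbf{w})-\mathbf{e}_{\mathbf{a}}(\sigma(\mathbf{w}))$ stands for the $M$ polynomials $Q\,\sigma(w_k)^{\mu_k}-a_k-e_{a_k}$, $k=1,\ldots,M$. The endomorphism $\sigma$ fixes $\mathbb{K}$ and sends $\sigma^j(w_k)\mapsto\sigma^{j+1}(w_k)$, $\sigma^j(z)\mapsto\sigma^{j+1}(z)$. $I_{\mathcal{M}_f}$ is the difference ideal generated by $\mathcal{E}$, saturated by $\{Q,\sigma(Q),\sigma^2(Q),\ldots\}$. Its truncation $\langle\sigma^{\le M}(I_{\mathcal{M}_f})\rangle$ is the ideal of the polynomial ring $\mathbb{K}[\sigma^j(w_k),\sigma^j(z)\mid 1\le k\le M,\,0\le j\le M]$ generated by $\sigma^j(Q\,\sigma(w_k)^{\mu_k}-a_k-e_{a_k})$ for $1\le k\le M$, $0\le j\le M-1$, and $\sigma^j(Qz-b)$ for $0\le j\le M$, saturated by $H=\{Q,\sigma(Q),\ldots,\sigma^M(Q)\}$. Here $J:H^\infty$ is the set of polynomials $g$ such that $hg\in J$ for some product $h$ of powers of elements of $H$. $\mathbb{K}[\sigma^\infty(z)]=\mathbb{K}[z,\sigma(z),\sigma^2(z),\ldots]$.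 A set of nonconstant polynomials is triangular with respect to an ordering of the variables if the leading variables (highest occurring variables) of its elements are pairwise distinct. *)

theory Defs
  imports
    Complex_Main
    "HOL-Library.Poly_Mapping"
    "HOL-Library.Countable"
    "HOL-Computational_Algebra.Polynomial"
    "HOL-Computational_Algebra.Fraction_Field"
begin

section \<open>Multivariate polynomials and rational functions\<close>

text \<open>A polynomial is a finitely supported map from monomials to coefficients; a monomial is a
  finitely supported map from variables to exponents.\<close>

type_synonym ('v, 'a) mpoly = "('v \<Rightarrow>\<^sub>0 nat) \<Rightarrow>\<^sub>0 'a"

definition pconst :: "'a::comm_ring_1 \<Rightarrow> ('v, 'a) mpoly" where
  "pconst c = Poly_Mapping.single 0 c"

definition pvar :: "'v \<Rightarrow> ('v, 'a::comm_ring_1) mpoly" where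
  "pvar v = Poly_Mapping.single (Poly_Mapping.single v 1) 1"

definition vars :: "('v, 'a::comm_ring_1) mpoly \<Rightarrow> 'v set" where
  "vars q = (\<Union>m\<in>Poly_Mapping.keys q. Poly_Mapping.keys m)"

text \<open>The polynomial subring in the variables from \<open>V\<close>, and the subfield of its fractions.\<close>

definition polys_in :: "'v set \<Rightarrow> ('v, 'a::comm_ring_1) mpoly set" where
  "polys_in V = {q. vars q \<subseteq> V}"

definition ratfuns_in :: "'v::linorder set \<Rightarrow> ('v, 'a::idom) mpoly fract set" where
  "ratfuns_in V = {Fract g h | g h. g \<in> polys_in V \<and> h \<in> polys_in V \<and> h \<noteq> 0}"

definition deg_in :: "'v \<Rightarrow> ('v, 'a::comm_ring_1) mpoly \<Rightarrow> nat" where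
  "deg_in v q = Max (insert 0 ((\<lambda>m. Poly_Mapping.lookup m v) ` Poly_Mapping.keys q))"

text \<open>The coefficient of \<open>v ^ d\<close>, \<open>q\<close> being regarded as a univariate polynomial in \<open>v\<close>.\<close>

definition coeff_in :: "'v \<Rightarrow> nat \<Rightarrow> ('v, 'a::comm_ring_1) mpoly \<Rightarrow> ('v, 'a) mpoly" where
  "coeff_in v d q = (\<Sum>m\<in>{m \<in> Poly_Mapping.keys q. Poly_Mapping.lookup m v = d}.
     Poly_Mapping.single (Poly_Mapping.update v 0 m) (Poly_Mapping.lookup q m))"

text \<open>The homomorphism of algebras over the coefficient ring that sends each variable \<open>v\<close> to \<open>h v\<close>.\<close>

definition psubst :: "('v \<Rightarrow> ('u, 'a::comm_ring_1) mpoly) \<Rightarrow> ('v, 'a) mpoly \<Rightarrow> ('u, 'a) mpoly" where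
  "psubst h q = (\<Sum>m\<in>Poly_Mapping.keys q. pconst (Poly_Mapping.lookup q m) *
     (\<Prod>v\<in>Poly_Mapping.keys m. h v ^ Poly_Mapping.lookup m v))"

text \<open>Substitution into a rational function. The value does not depend on the chosen
  representation as a fraction; it exists as soon as some representation has a denominator that
  does not become zero, which is always so when distinct variables are substituted for distinct
  variables.\<close>

definition ratsubst ::
    "('v::linorder \<Rightarrow> ('u::linorder, 'a::idom) mpoly) \<Rightarrow> ('v, 'a) mpoly fract \<Rightarrow> ('u, 'a) mpoly fract"
  where
  "ratsubst h f = (THE r. \<exists>num den. den \<noteq> 0 \<and> psubst h den \<noteq> 0 \<and>
     f = Fract num den \<and> r = Fract (psubst h num) (psubst h den))"

section \<open>Difference polynomials in one indeterminate\<close>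

text \<open>In a polynomial over the variables \<open>nat\<close>, the variable \<open>j\<close> stands for
  \<open>\<sigma>\<^sup>j(s)\<close>.\<close>

type_synonym 'a dpoly = "(nat, 'a) mpoly"

text \<open>Only meaningful for nonconstant polynomials.\<close>

definition dorder :: "'a::comm_ring_1 dpoly \<Rightarrow> nat" where
  "dorder q = Max (vars q)"

definition ddegree :: "'a::comm_ring_1 dpoly \<Rightarrow> nat" where
  "ddegree q = deg_in (dorder q) q"

definition initial :: "'a::comm_ring_1 dpoly \<Rightarrow> 'a dpoly" where
  "initial q = coeff_in (dorder q) (ddegree q) q"

text \<open>The polynomial \<open>p\<^sub>i\<^sub>,\<^sub>1\<close> in \<open>p\<^sub>i = initial p\<^sub>i * \<sigma>\<^sup>n(s\<^sub>i) ^ m\<^sub>i + p\<^sub>i\<^sub>,\<^sub>1\<close>, followed by its parts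
  free of and containing the highest variable.\<close>

definition dtail :: "'a::comm_ring_1 dpoly \<Rightarrow> 'a dpoly" where
  "dtail q = q - initial q * pvar (dorder q) ^ ddegree q"

definition dtail_free :: "'a::comm_ring_1 dpoly \<Rightarrow> 'a dpoly" where
  "dtail_free q = coeff_in (dorder q) 0 (dtail q)"

definition dtail_involving :: "'a::comm_ring_1 dpoly \<Rightarrow> 'a dpoly" where
  "dtail_involving q = dtail q - dtail_free q"

section \<open>The difference ring of the system\<close>

text \<open>\<open>W k j\<close> stands for \<open>\<sigma>\<^sup>j(w\<^sub>k)\<close> with \<open>k\<close> counted from 1, and \<open>Z j\<close> for \<open>\<sigma>\<^sup>j(z)\<close>.\<close>

datatype svar = W nat nat | Z nat

instance svar :: countable
  by countable_datatype

text \<open>The following linear order has no mathematical meaning. The library derives the absence of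
  zero divisors in a polynomial ring, hence the existence of its field of fractions, from some
  linear order on the variables. It is not the ordering of variables with respect to which
  triangularity is considered; that one is an arbitrary relation.\<close>

instantiation svar :: linorder
begin

definition less_eq_svar :: "svar \<Rightarrow> svar \<Rightarrow> bool" where
  "less_eq_svar u v \<longleftrightarrow> to_nat u \<le> to_nat v"

definition less_svar :: "svar \<Rightarrow> svar \<Rightarrow> bool" where
  "less_svar u v \<longleftrightarrow> to_nat u < to_nat v"

instance
  by standard (auto simp: less_eq_svar_def less_svar_def)

end

type_synonym 'a spoly = "(svar, 'a) mpoly"

definition sigma :: "'a::comm_ring_1 spoly \<Rightarrow> 'a spoly" where
  "sigma = psubst (\<lambda>v. case v of W k j \<Rightarrow> pvar (W k (Suc j)) | Z j \<Rightarrow> pvar (Z (Suc j)))"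

section \<open>Radical-rational dynamical systems\<close>

text \<open>\<open>M\<^sub>i = n\<^sub>1 + \<dots> + n\<^sub>i\<close>\<close>

definition Mdim :: "(nat \<Rightarrow> 'a::comm_ring_1 dpoly) \<Rightarrow> nat \<Rightarrow> nat" where
  "Mdim p i = (\<Sum>l=1..i. dorder (p l))"

text \<open>The variable that represents \<open>\<sigma>\<^sup>j(s\<^sub>i)\<close>: this is \<open>w\<close> with index \<open>M\<^sub>i\<^sub>-\<^sub>1 + j + 1\<close> for
  \<open>j < n\<^sub>i\<close>, and \<open>\<sigma>(w)\<close> with index \<open>M\<^sub>i\<close> for \<open>j = n\<^sub>i\<close>.\<close>

definition wvar :: "(nat \<Rightarrow> 'a::comm_ring_1 dpoly) \<Rightarrow> nat \<Rightarrow> nat \<Rightarrow> svar" where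
  "wvar p i j = (if j < dorder (p i) then W (Mdim p (i - 1) + j + 1) 0
                 else W (Mdim p i) (j - dorder (p i) + 1))"

definition to_w :: "(nat \<Rightarrow> 'a::comm_ring_1 dpoly) \<Rightarrow> nat \<Rightarrow> 'a dpoly \<Rightarrow> 'a spoly" where
  "to_w p i = psubst (\<lambda>j. pvar (wvar p i j))"

text \<open>\<open>Q\<close>, \<open>\<mu>\<close>, \<open>a\<close>, \<open>e\<close>, \<open>b\<close> are polynomial data of the system: \<open>Q\<close> is a common denominator, and
  \<open>a k / Q\<close>, \<open>e k / Q\<close> and \<open>b / Q\<close> are the rational functions \<open>A\<^sub>k\<close>, \<open>E\<close> with index \<open>A\<^sub>k\<close>, and \<open>B\<close>.
  That \<open>a k\<close>, \<open>b\<close> involve only the \<open>w\<close>'s and \<open>e k\<close> in addition only \<open>\<sigma>(w\<^sub>k)\<close> follows.\<close>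

definition radical_rational_data ::
    "nat \<Rightarrow> (nat \<Rightarrow> 'a::idom dpoly) \<Rightarrow> (nat, 'a) mpoly fract \<Rightarrow>
     'a spoly \<Rightarrow> (nat \<Rightarrow> nat) \<Rightarrow> (nat \<Rightarrow> 'a spoly) \<Rightarrow> (nat \<Rightarrow> 'a spoly) \<Rightarrow> 'a spoly \<Rightarrow> bool"
  where
  "radical_rational_data N p f Q \<mu> a e b \<longleftrightarrow>
     Q \<noteq> 0 \<and> Q \<in> polys_in {W k 0 | k. k \<in> {1..Mdim p N}} \<and>
     (\<forall>k\<in>{1..Mdim p N}. k \<notin> Mdim p ` {1..N} \<longrightarrow>
        \<mu> k = 1 \<and> Fract (a k) Q = Fract (pvar (W (k + 1) 0)) 1 \<and> Fract (e k) Q = 0) \<and>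
     (\<forall>i\<in>{1..N}.
        \<mu> (Mdim p i) = ddegree (p i) \<and>
        Fract (a (Mdim p i)) Q = - Fract (to_w p i (dtail_free (p i))) (to_w p i (initial (p i))) \<and>
        Fract (e (Mdim p i)) Q = - Fract (to_w p i (dtail_involving (p i))) (to_w p i (initial (p i)))) \<and>
     Fract b Q = ratsubst (\<lambda>i. pvar (W (Mdim p (i - 1) + 1) 0)) f"

definition w_equation ::
    "'a::comm_ring_1 spoly \<Rightarrow> (nat \<Rightarrow> nat) \<Rightarrow> (nat \<Rightarrow> 'a spoly) \<Rightarrow> (nat \<Rightarrow> 'a spoly) \<Rightarrow> nat \<Rightarrow> 'a spoly" where
  "w_equation Q \<mu> a e k = Q * pvar (W k 1) ^ \<mu> k - a k - e k"

definition z_equation :: "'a::comm_ring_1 spoly \<Rightarrow> 'a spoly \<Rightarrow> 'a spoly" where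
  "z_equation Q b = Q * pvar (Z 0) - b"

definition equation_set ::
    "nat \<Rightarrow> 'a::comm_ring_1 spoly \<Rightarrow> (nat \<Rightarrow> nat) \<Rightarrow> (nat \<Rightarrow> 'a spoly) \<Rightarrow> (nat \<Rightarrow> 'a spoly) \<Rightarrow> 'a spoly
     \<Rightarrow> 'a spoly set" where
  "equation_set M Q \<mu> a e b = w_equation Q \<mu> a e ` {1..M} \<union> {z_equation Q b}"

section \<open>Triangular sets\<close>

text \<open>An ordering of the variables is given by a relation \<open>r\<close>; \<open>(u, v) \<in> r\<close> means that \<open>v\<close> is
  higher than \<open>u\<close>.\<close>

definition lead_var :: "('v \<times> 'v) set \<Rightarrow> ('v, 'a::comm_ring_1) mpoly \<Rightarrow> 'v" where
  "lead_var r q = (THE v. v \<in> vars q \<and> (\<forall>u\<in>vars q. u \<noteq> v \<longrightarrow> (u, v) \<in> r))"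

definition triangular :: "('v \<times> 'v) set \<Rightarrow> ('v, 'a::comm_ring_1) mpoly set \<Rightarrow> bool" where
  "triangular r S \<longleftrightarrow> (\<forall>q\<in>S. vars q \<noteq> {}) \<and> inj_on (lead_var r) S"

definition admissible_ordering :: "nat \<Rightarrow> (svar \<times> svar) set \<Rightarrow> bool" where
  "admissible_ordering M r \<longleftrightarrow>
     strict_linear_order_on ({W i j | i j. i \<in> {1..M}} \<union> {Z j | j. True}) r \<and>
     (\<forall>i\<in>{1..M}. \<forall>j1 j2. (W i j2, Z j1) \<in> r) \<and>
     (\<forall>j. (Z j, Z (j + 1)) \<in> r) \<and>
     (\<forall>i1\<in>{1..M}. \<forall>i2\<in>{1..M}. \<forall>j. (W i2 j, W i1 (j + 1)) \<in> r)"

section \<open>The truncated ideal\<close>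

text \<open>The ideal generated by \<open>G\<close> in a subring \<open>R\<close> that contains \<open>G\<close>, and the saturation by \<open>H\<close>
  of an ideal \<open>J\<close> of a subring \<open>R\<close> that contains \<open>H\<close>.\<close>

definition ideal_in :: "'r::comm_ring_1 set \<Rightarrow> 'r set \<Rightarrow> 'r set" where
  "ideal_in R G = {\<Sum>g\<in>F. c g * g | F c. finite F \<and> F \<subseteq> G \<and> (\<forall>g\<in>F. c g \<in> R)}"

definition saturation_in :: "'r::comm_ring_1 set \<Rightarrow> 'r set \<Rightarrow> 'r set \<Rightarrow> 'r set" where
  "saturation_in R J H =
     {g \<in> R. \<exists>F n. finite F \<and> F \<subseteq> H \<and> (\<Prod>h\<in>F. h ^ (n h :: nat)) * g \<in> J}"

definition truncated_ideal ::
    "nat \<Rightarrow> 'a::comm_ring_1 spoly \<Rightarrow> (nat \<Rightarrow> nat) \<Rightarrow> (nat \<Rightarrow> 'a spoly) \<Rightarrow> (nat \<Rightarrow> 'a spoly) \<Rightarrow> 'a spoly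
     \<Rightarrow> 'a spoly set" where
  "truncated_ideal M Q \<mu> a e b =
     (let R = polys_in ({W k j | k j. k \<in> {1..M} \<and> j \<le> M} \<union> {Z j | j. j \<le> M});
          G = {(sigma ^^ j) (w_equation Q \<mu> a e k) | k j. k \<in> {1..M} \<and> j < M} \<union>
              {(sigma ^^ j) (z_equation Q b) | j. j \<le> M};
          H = {(sigma ^^ j) Q | j. j \<le> M}
      in saturation_in R (ideal_in R G) H)"

end

theory Submission
  imports Defs "HOL-Library.FuncSet"
begin

text \<open>
  Triangularity is a matter of degrees. Put \<open>t\<^sub>k = a\<^sub>k + e\<^sub>k\<close>. Up to the factor \<open>Q\<close> and the initial of
  \<open>p\<^sub>i\<close>, this is the tail of \<open>p\<^sub>i\<close> (or a single variable \<open>w\<^sub>k\<^sub>+\<^sub>1\<close>), so its degree in \<open>\<sigma>(w\<^sub>k)\<close> is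
  less than \<open>\<mu>\<^sub>k\<close>, and otherwise it involves only \<open>w\<close>'s (\<open>equation_tail\<close>). Degrees are additive because
  polynomials over a field form a domain, so the factors can be cancelled. Hence \<open>\<sigma>(w\<^sub>k)\<close> survives in
  \<open>Q \<sigma>(w\<^sub>k)\<^sup>\<mu> - t\<^sub>k\<close> and is its leading variable, as \<open>z\<close> is of \<open>Q z - b\<close>.

  The existence of a relation between \<open>z, \<sigma>(z), \<dots>, \<sigma>\<^sup>M(z)\<close> expresses that \<open>M + 1\<close> elements cannot be
  independent modulo an ideal that leaves only the \<open>M\<close> variables \<open>w\<^sub>1, \<dots>, w\<^sub>M\<close> free. The ideal need be
  neither prime nor radical, and a power of some \<open>\<sigma>\<^sup>j(Q)\<close> may lie in it, so transcendence degrees are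
  replaced by counting monomials. A relation \<open>h v\<^sup>\<mu> \<equiv> t\<close> with \<open>deg\<^sub>v t < \<mu>\<close> permits to rewrite, after
  multiplication by a power of \<open>h\<close>, any polynomial into one of degree less than \<open>\<mu>\<close> in \<open>v\<close>, and the
  degrees in the other variables grow at most linearly (\<open>eliminate_variable\<close>). Doing this for
  \<open>\<sigma>\<^sup>j(z)\<close>, and then for the \<open>\<sigma>\<^sup>j(w\<^sub>k)\<close> with \<open>j\<close> decreasing from \<open>M\<close> to \<open>1\<close>, one common multiplier
  brings all \<open>(d + 1)\<^sup>M\<^sup>+\<^sup>1\<close> monomials in the \<open>\<sigma>\<^sup>j(z)\<close> with exponents at most \<open>d\<close> into the
  span of \<open>C (c d + 1)\<^sup>M\<close> monomials, where \<open>C\<close> and \<open>c\<close> do not depend on \<open>d\<close>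
  (\<open>eliminate_variables\<close>). For large \<open>d\<close> there are fewer of the latter than of the former, and a
  linear relation between the normal forms is a polynomial in the \<open>\<sigma>\<^sup>j(z)\<close> that the multiplier carries
  into the ideal (\<open>elimination_dependence\<close>).
\<close>


section \<open>Degrees and variables of multivariate polynomials\<close>

text \<open>The monomials are restricted to those of \<open>q\<close>, so that the last case inherits bounds on the degrees
  of \<open>q\<close>.\<close>

lemma mpoly_induct [consumes 0, case_names zero add monomial]:
  fixes q :: "('v, 'a::comm_ring_1) mpoly"
  assumes "P 0" and "\<And>x y. P x \<Longrightarrow> P y \<Longrightarrow> P (x + y)"
    and "\<And>m c. m \<in> Poly_Mapping.keys q \<Longrightarrow> P (Poly_Mapping.single m c)"
  shows "P q"
proof -
  have sum: "P (\<Sum>m\<in>A. Poly_Mapping.single m (Poly_Mapping.lookup q m))"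
    if "finite A" "A \<subseteq> Poly_Mapping.keys q" for A
    using that by (induction rule: finite_induct) (auto intro: assms)
  have "P (\<Sum>m\<in>Poly_Mapping.keys q. Poly_Mapping.single m (Poly_Mapping.lookup q m))"
    by (rule sum) auto
  moreover have "(\<Sum>m\<in>Poly_Mapping.keys q. Poly_Mapping.single m (Poly_Mapping.lookup q m)) = q"
    by (rule poly_mapping_eqI)
       (auto simp: lookup_sum lookup_single when_def in_keys_iff)
  ultimately show ?thesis by (rule back_subst[of P])
qed

lemma deg_in_le_iff: "deg_in v q \<le> n \<longleftrightarrow> (\<forall>m\<in>Poly_Mapping.keys q. Poly_Mapping.lookup m v \<le> n)"
  by (simp add: deg_in_def)

lemma lookup_le_deg_in: "m \<in> Poly_Mapping.keys q \<Longrightarrow> Poly_Mapping.lookup m v \<le> deg_in v q"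
  using deg_in_le_iff[of v q "deg_in v q"] by simp

lemma nonzero_has_key:
  assumes "q \<noteq> 0"
  shows "\<exists>m. m \<in> Poly_Mapping.keys q"
  using keys_eq_empty[of q] assms by blast

lemma deg_in_attained:
  assumes "q \<noteq> 0"
  obtains m where "m \<in> Poly_Mapping.keys q" "Poly_Mapping.lookup m v = deg_in v q"
proof -
  have "Poly_Mapping.keys q \<noteq> {}" using assms by (simp add: keys_eq_empty)
  then have "deg_in v q = Max ((\<lambda>m. Poly_Mapping.lookup m v) ` Poly_Mapping.keys q)"
    by (simp add: deg_in_def)
  also have "\<dots> \<in> (\<lambda>m. Poly_Mapping.lookup m v) ` Poly_Mapping.keys q"
    using \<open>Poly_Mapping.keys q \<noteq> {}\<close> by (intro Max_in) auto
  finally show ?thesis using that by auto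
qed

lemma in_vars_iff_deg_in: "v \<in> vars q \<longleftrightarrow> 0 < deg_in v q"
proof -
  have "deg_in v q \<le> 0 \<longleftrightarrow> v \<notin> vars q"
    unfolding deg_in_le_iff vars_def by (auto simp: in_keys_iff)
  then show ?thesis by linarith
qed

lemma deg_in_eq_0_iff: "deg_in v q = 0 \<longleftrightarrow> v \<notin> vars q"
  using in_vars_iff_deg_in[of v q] by simp

lemma deg_in_zero [simp]: "deg_in v 0 = 0"
  by (simp add: deg_in_def)

lemma deg_in_one [simp]: "deg_in v 1 = 0"
  by (simp add: deg_in_def)

lemma deg_in_single: "deg_in v (Poly_Mapping.single m c) \<le> Poly_Mapping.lookup m v"
  by (simp add: deg_in_le_iff)

lemma deg_in_pvar: "deg_in v (pvar u :: ('v, 'a::comm_ring_1) mpoly) = (if v = u then 1 else 0)"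
  by (simp add: deg_in_def pvar_def lookup_single when_def)

lemma deg_in_uminus [simp]: "deg_in v (- q) = deg_in v q"
  by (simp add: deg_in_def)

lemma deg_in_add_le: "deg_in v (x + y) \<le> max (deg_in v x) (deg_in v y)"
  unfolding deg_in_le_iff
proof
  fix m assume "m \<in> Poly_Mapping.keys (x + y)"
  then have "m \<in> Poly_Mapping.keys x \<or> m \<in> Poly_Mapping.keys y"
    by (auto dest!: subsetD[OF keys_add])
  then show "Poly_Mapping.lookup m v \<le> max (deg_in v x) (deg_in v y)"
    using lookup_le_deg_in[of m x v] lookup_le_deg_in[of m y v] by auto
qed

lemma deg_in_diff_le: "deg_in v (x - y) \<le> max (deg_in v x) (deg_in v y)"
  using deg_in_add_le[of v x "- y"] by simp

lemma deg_in_mult_le: "deg_in v (x * y) \<le> deg_in v x + deg_in v y"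
  unfolding deg_in_le_iff
proof
  fix m assume "m \<in> Poly_Mapping.keys (x * y)"
  then obtain m1 m2 where "m = m1 + m2" "m1 \<in> Poly_Mapping.keys x" "m2 \<in> Poly_Mapping.keys y"
    by (auto dest!: subsetD[OF keys_mult])
  then show "Poly_Mapping.lookup m v \<le> deg_in v x + deg_in v y"
    by (simp add: lookup_add add_mono lookup_le_deg_in)
qed

lemma deg_in_power_le: "deg_in v (x ^ n) \<le> n * deg_in v x"
proof (induction n)
  case (Suc n)
  then show ?case using deg_in_mult_le[of v x "x ^ n"] by simp
qed simp

text \<open>Over a domain the monomials of top degree in \<open>v\<close> of two factors multiply to something
  nonzero, and nothing else in the product reaches that degree.\<close>

lemma deg_in_mult:
  fixes x y :: "('v::linorder, 'a::idom) mpoly"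
  assumes "x \<noteq> 0" "y \<noteq> 0"
  shows "deg_in v (x * y) = deg_in v x + deg_in v y"
proof -
  define top :: "('v, 'a) mpoly \<Rightarrow> ('v, 'a) mpoly" where
    "top z = (\<Sum>m | m \<in> Poly_Mapping.keys z \<and> Poly_Mapping.lookup m v = deg_in v z.
                Poly_Mapping.single m (Poly_Mapping.lookup z m))" for z
  have lookup_top: "Poly_Mapping.lookup (top z) m =
      (if Poly_Mapping.lookup m v = deg_in v z then Poly_Mapping.lookup z m else 0)" for z m
    by (auto simp: top_def lookup_sum lookup_single when_def in_keys_iff)
  have keys_top: "Poly_Mapping.lookup m v = deg_in v z" if "m \<in> Poly_Mapping.keys (top z)" for z m
    using that by (auto simp: in_keys_iff lookup_top split: if_splits)
  have top_nz: "top z \<noteq> 0" if "z \<noteq> 0" for z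
  proof -
    obtain m where "m \<in> Poly_Mapping.keys z" "Poly_Mapping.lookup m v = deg_in v z"
      using deg_in_attained[OF \<open>z \<noteq> 0\<close>] .
    then show ?thesis using lookup_top[of z m] by (auto simp: in_keys_iff)
  qed
  have keys_rest: "Poly_Mapping.lookup m v < deg_in v z"
    if "m \<in> Poly_Mapping.keys (z - top z)" for z m
  proof -
    have "m \<in> Poly_Mapping.keys z" "Poly_Mapping.lookup m v \<noteq> deg_in v z"
      using that by (auto simp: in_keys_iff lookup_minus lookup_top split: if_splits)
    then show ?thesis using lookup_le_deg_in[of m z v] by linarith
  qed
  obtain m where m: "m \<in> Poly_Mapping.keys (top x * top y)"
    using nonzero_has_key[of "top x * top y"] top_nz[OF assms(1)] top_nz[OF assms(2)] by auto
  then obtain m1 m2 where "m = m1 + m2" "m1 \<in> Poly_Mapping.keys (top x)" "m2 \<in> Poly_Mapping.keys (top y)"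
    by (auto dest!: subsetD[OF keys_mult])
  then have mv: "Poly_Mapping.lookup m v = deg_in v x + deg_in v y"
    by (simp add: lookup_add keys_top)
  have 1: "m \<notin> Poly_Mapping.keys ((x - top x) * y)"
  proof
    assume "m \<in> Poly_Mapping.keys ((x - top x) * y)"
    then obtain m1 m2 where "m = m1 + m2" "m1 \<in> Poly_Mapping.keys (x - top x)" "m2 \<in> Poly_Mapping.keys y"
      by (auto dest!: subsetD[OF keys_mult])
    then show False using mv keys_rest[of m1 x] lookup_le_deg_in[of m2 y v] by (simp add: lookup_add)
  qed
  have 2: "m \<notin> Poly_Mapping.keys (top x * (y - top y))"
  proof
    assume "m \<in> Poly_Mapping.keys (top x * (y - top y))"
    then obtain m1 m2 where "m = m1 + m2" "m1 \<in> Poly_Mapping.keys (top x)" "m2 \<in> Poly_Mapping.keys (y - top y)"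
      by (auto dest!: subsetD[OF keys_mult])
    then show False using mv keys_rest[of m2 y] keys_top[of m1 x] by (simp add: lookup_add)
  qed
  have "x * y = top x * top y + ((x - top x) * y + top x * (y - top y))"
    by (simp add: algebra_simps)
  then have "m \<in> Poly_Mapping.keys (x * y)"
    using m 1 2 by (simp add: in_keys_iff lookup_add)
  then have "deg_in v x + deg_in v y \<le> deg_in v (x * y)"
    using mv lookup_le_deg_in[of m "x * y" v] by simp
  then show ?thesis using deg_in_mult_le[of v x y] by linarith
qed

lemma vars_mult:
  fixes x y :: "('v::linorder, 'a::idom) mpoly"
  assumes "x \<noteq> 0" "y \<noteq> 0"
  shows "vars (x * y) = vars x \<union> vars y"
  using deg_in_mult[OF assms] by (auto simp: in_vars_iff_deg_in)

lemma deg_in_power: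
  fixes x :: "('v::linorder, 'a::idom) mpoly"
  assumes "x \<noteq> 0"
  shows "deg_in v (x ^ n) = n * deg_in v x"
  using assms by (induction n) (simp_all add: deg_in_mult)

lemma pvar_nonzero [simp]: "(pvar v :: ('v, 'a::comm_ring_1) mpoly) \<noteq> 0"
  using deg_in_pvar[of v v, where 'a = 'a] by auto

lemma vars_pvar [simp]: "vars (pvar v :: ('v, 'a::comm_ring_1) mpoly) = {v}"
  by (auto simp: in_vars_iff_deg_in deg_in_pvar split: if_splits)

lemma vars_zero [simp]: "vars 0 = {}"
  by (simp add: vars_def)

lemma vars_uminus [simp]: "vars (- x) = vars x"
  by (simp add: vars_def)

lemma finite_vars [simp]: "finite (vars x)"
  by (simp add: vars_def)

lemma polys_in_iff: "x \<in> polys_in V \<longleftrightarrow> (\<forall>v. v \<notin> V \<longrightarrow> deg_in v x = 0)"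
  by (auto simp: polys_in_def in_vars_iff_deg_in)

lemma polys_in_mono: "V \<subseteq> V' \<Longrightarrow> x \<in> polys_in V \<Longrightarrow> x \<in> polys_in V'"
  by (auto simp: polys_in_def)

lemma zero_in_polys_in [simp]: "0 \<in> polys_in V"
  by (simp add: polys_in_iff)

lemma one_in_polys_in [simp]: "1 \<in> polys_in V"
  by (simp add: polys_in_iff)

lemma pvar_in_polys_in [simp]: "pvar v \<in> polys_in V \<longleftrightarrow> v \<in> V"
  by (simp add: polys_in_def)

lemma polys_in_uminus [simp]: "- x \<in> polys_in V \<longleftrightarrow> x \<in> polys_in V"
  by (simp add: polys_in_def)

lemma polys_in_add: "x \<in> polys_in V \<Longrightarrow> y \<in> polys_in V \<Longrightarrow> x + y \<in> polys_in V"
  unfolding polys_in_iff using deg_in_add_le[of _ x y] by (metis (no_types, lifting) le_zero_eq max.idem)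

lemma polys_in_diff: "x \<in> polys_in V \<Longrightarrow> y \<in> polys_in V \<Longrightarrow> x - y \<in> polys_in V"
  unfolding polys_in_iff using deg_in_diff_le[of _ x y] by (metis (no_types, lifting) le_zero_eq max.idem)

lemma polys_in_mult: "x \<in> polys_in V \<Longrightarrow> y \<in> polys_in V \<Longrightarrow> x * y \<in> polys_in V"
  unfolding polys_in_iff using deg_in_mult_le[of _ x y] by (metis le_zero_eq add_0)

lemma polys_in_power: "x \<in> polys_in V \<Longrightarrow> x ^ n \<in> polys_in V"
  by (induction n) (auto intro: polys_in_mult)

lemma polys_in_sum: "(\<And>i. i \<in> A \<Longrightarrow> x i \<in> polys_in V) \<Longrightarrow> (\<Sum>i\<in>A. x i) \<in> polys_in V"
  by (induction A rule: infinite_finite_induct) (auto intro: polys_in_add)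

lemma polys_in_factor:
  fixes x y :: "('v::linorder, 'a::idom) mpoly"
  assumes "x \<noteq> 0" "x * y \<in> polys_in V"
  shows "y \<in> polys_in V"
  using assms by (cases "y = 0") (auto simp: polys_in_def vars_mult)


section \<open>Substitution\<close>

definition subst_monomial :: "('v \<Rightarrow> ('u, 'a::comm_ring_1) mpoly) \<Rightarrow> ('v \<Rightarrow>\<^sub>0 nat) \<Rightarrow> ('u, 'a) mpoly" where
  "subst_monomial h m = (\<Prod>v\<in>Poly_Mapping.keys m. h v ^ Poly_Mapping.lookup m v)"

lemma subst_monomial_superset:
  assumes "finite A" "Poly_Mapping.keys m \<subseteq> A"
  shows "subst_monomial h m = (\<Prod>v\<in>A. h v ^ Poly_Mapping.lookup m v)"
  unfolding subst_monomial_def using assms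
  by (intro prod.mono_neutral_left) (auto simp: in_keys_iff)

lemma subst_monomial_add: "subst_monomial h (m + n) = subst_monomial h m * subst_monomial h n"
proof -
  define A where "A = Poly_Mapping.keys m \<union> Poly_Mapping.keys n"
  have "Poly_Mapping.keys (m + n) \<subseteq> A" unfolding A_def by (rule keys_add)
  moreover have "finite A" "Poly_Mapping.keys m \<subseteq> A" "Poly_Mapping.keys n \<subseteq> A" by (auto simp: A_def)
  ultimately show ?thesis
    by (simp add: subst_monomial_superset lookup_add power_add prod.distrib)
qed

lemma pconst_mult: "pconst (c * d) = pconst c * pconst d"
  by (simp add: pconst_def mult_single)

lemma pconst_add: "pconst (c + d) = pconst c + pconst d"
  by (simp add: pconst_def single_add)

lemma psubst_superset:
  assumes "finite A" "Poly_Mapping.keys q \<subseteq> A"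
  shows "psubst h q = (\<Sum>m\<in>A. pconst (Poly_Mapping.lookup q m) * subst_monomial h m)"
  unfolding psubst_def subst_monomial_def[symmetric] using assms
  by (intro sum.mono_neutral_left) (auto simp: in_keys_iff pconst_def)

lemma psubst_zero [simp]: "psubst h 0 = 0"
  by (simp add: psubst_def)

lemma psubst_single: "psubst h (Poly_Mapping.single m c) = pconst c * subst_monomial h m"
  by (simp add: psubst_def subst_monomial_def pconst_def)

lemma psubst_add: "psubst h (x + y) = psubst h x + psubst h y"
proof -
  define A where "A = Poly_Mapping.keys x \<union> Poly_Mapping.keys y"
  have "Poly_Mapping.keys (x + y) \<subseteq> A" unfolding A_def by (rule keys_add)
  moreover have "finite A" "Poly_Mapping.keys x \<subseteq> A" "Poly_Mapping.keys y \<subseteq> A" by (auto simp: A_def)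
  ultimately show ?thesis
    by (simp add: psubst_superset lookup_add pconst_add sum.distrib distrib_right)
qed

lemma psubst_mult: "psubst h (x * y) = psubst h x * psubst h y"
proof (induction x rule: mpoly_induct)
  case (monomial m c)
  show ?case
  proof (induction y rule: mpoly_induct)
    case (monomial n d)
    show ?case
      by (simp add: mult_single psubst_single subst_monomial_add pconst_mult algebra_simps)
  qed (simp_all add: psubst_add distrib_left)
qed (simp_all add: psubst_add distrib_right)

lemma psubst_uminus: "psubst h (- x) = - psubst h x"
  using psubst_add[of h x "- x"] by (simp add: eq_neg_iff_add_eq_0 add.commute)

lemma psubst_diff: "psubst h (x - y) = psubst h x - psubst h y"
  using psubst_add[of h x "- y"] by (simp add: psubst_uminus)

lemma psubst_one [simp]: "psubst h 1 = 1"
  using psubst_single[of h 0 1] by (simp add: subst_monomial_def pconst_def)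

lemma psubst_power: "psubst h (x ^ n) = psubst h x ^ n"
  by (induction n) (simp_all add: psubst_mult)

lemma psubst_pvar: "psubst h (pvar v) = h v"
  unfolding pvar_def by (simp add: psubst_single subst_monomial_def pconst_def)

text \<open>A renaming of variables sends monomials to monomials.\<close>

definition rename_monomial :: "('v \<Rightarrow> 'u) \<Rightarrow> ('v \<Rightarrow>\<^sub>0 nat) \<Rightarrow> ('u \<Rightarrow>\<^sub>0 nat)" where
  "rename_monomial \<rho> m = (\<Sum>v\<in>Poly_Mapping.keys m. Poly_Mapping.single (\<rho> v) (Poly_Mapping.lookup m v))"

lemma pvar_power: "pvar v ^ n = Poly_Mapping.single (Poly_Mapping.single v n) 1"
  by (induction n) (simp_all add: pvar_def mult_single flip: single_add)

lemma subst_monomial_rename: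
  "subst_monomial (\<lambda>v. pvar (\<rho> v)) m = Poly_Mapping.single (rename_monomial \<rho> m) 1"
proof -
  have "(\<Prod>v\<in>A. pvar (\<rho> v) ^ Poly_Mapping.lookup m v) =
      Poly_Mapping.single (\<Sum>v\<in>A. Poly_Mapping.single (\<rho> v) (Poly_Mapping.lookup m v)) (1 :: 'b::comm_ring_1)"
    if "finite A" for A
    using that by (induction rule: finite_induct) (simp_all add: pvar_power mult_single)
  then show ?thesis by (simp add: subst_monomial_def rename_monomial_def)
qed

lemma lookup_rename_monomial:
  assumes "inj_on \<rho> V" "Poly_Mapping.keys m \<subseteq> V" "v \<in> V"
  shows "Poly_Mapping.lookup (rename_monomial \<rho> m) (\<rho> v) = Poly_Mapping.lookup m v"
proof -
  have "\<rho> w = \<rho> v \<longleftrightarrow> w = v" if "w \<in> Poly_Mapping.keys m" for w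
    using assms that by (auto dest: inj_onD)
  then have "Poly_Mapping.lookup (rename_monomial \<rho> m) (\<rho> v) =
      (\<Sum>w\<in>Poly_Mapping.keys m. if w = v then Poly_Mapping.lookup m w else 0)"
    unfolding rename_monomial_def
    by (auto simp: lookup_sum lookup_single when_def intro!: sum.cong)
  also have "\<dots> = Poly_Mapping.lookup m v" by (simp add: in_keys_iff)
  finally show ?thesis .
qed

lemma keys_rename_monomial: "Poly_Mapping.keys (rename_monomial \<rho> m) \<subseteq> \<rho> ` Poly_Mapping.keys m"
  unfolding rename_monomial_def
  by (rule order_trans[OF keys_sum]) (auto split: if_splits)

lemma keys_rename:
  "Poly_Mapping.keys (psubst (\<lambda>v. pvar (\<rho> v)) q) \<subseteq> rename_monomial \<rho> ` Poly_Mapping.keys q"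
  unfolding psubst_def subst_monomial_def[symmetric] subst_monomial_rename
  by (rule order_trans[OF keys_sum]) (auto simp: pconst_def mult_single split: if_splits)

lemma vars_rename: "vars (psubst (\<lambda>v. pvar (\<rho> v)) q) \<subseteq> \<rho> ` vars q"
  using keys_rename[of \<rho> q] keys_rename_monomial[of \<rho>] unfolding vars_def by blast

lemma deg_in_rename_le:
  assumes "inj_on \<rho> (insert v (vars q))"
  shows "deg_in (\<rho> v) (psubst (\<lambda>v. pvar (\<rho> v)) q) \<le> deg_in v q"
  unfolding deg_in_le_iff
proof
  fix m assume "m \<in> Poly_Mapping.keys (psubst (\<lambda>v. pvar (\<rho> v)) q)"
  then obtain m' where m': "m' \<in> Poly_Mapping.keys q" "m = rename_monomial \<rho> m'"
    by (auto dest!: subsetD[OF keys_rename])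
  then have "Poly_Mapping.keys m' \<subseteq> insert v (vars q)" by (auto simp: vars_def)
  then show "Poly_Mapping.lookup m (\<rho> v) \<le> deg_in v q"
    using m' lookup_rename_monomial[OF assms, of m' v] by (simp add: lookup_le_deg_in)
qed

lemma rename_nonzero:
  assumes inj: "inj_on \<rho> (vars q)" and "q \<noteq> 0"
  shows "psubst (\<lambda>v. pvar (\<rho> v)) q \<noteq> 0"
proof
  assume 0: "psubst (\<lambda>v. pvar (\<rho> v)) q = 0"
  obtain m where m: "m \<in> Poly_Mapping.keys q"
    using nonzero_has_key[OF \<open>q \<noteq> 0\<close>] by auto
  have inj': "rename_monomial \<rho> n = rename_monomial \<rho> m \<longleftrightarrow> n = m" if "n \<in> Poly_Mapping.keys q" for n
  proof
    assume eq: "rename_monomial \<rho> n = rename_monomial \<rho> m"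
    have sub: "Poly_Mapping.keys n \<subseteq> vars q" "Poly_Mapping.keys m \<subseteq> vars q"
      using m that by (auto simp: vars_def)
    show "n = m"
    proof (rule poly_mapping_eqI)
      fix v
      show "Poly_Mapping.lookup n v = Poly_Mapping.lookup m v"
      proof (cases "v \<in> vars q")
        case True
        then show ?thesis using lookup_rename_monomial[OF inj sub(1) True]
            lookup_rename_monomial[OF inj sub(2) True] eq by simp
      next
        case False
        then have "v \<notin> Poly_Mapping.keys n" "v \<notin> Poly_Mapping.keys m" using sub by auto
        then show ?thesis by (simp add: in_keys_iff)
      qed
    qed
  qed simp
  have "Poly_Mapping.lookup (psubst (\<lambda>v. pvar (\<rho> v)) q) (rename_monomial \<rho> m) =
      (\<Sum>n\<in>Poly_Mapping.keys q. if n = m then Poly_Mapping.lookup q n else 0)"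
    unfolding psubst_def subst_monomial_def[symmetric] subst_monomial_rename
    using inj' by (auto simp: lookup_sum pconst_def mult_single lookup_single when_def intro!: sum.cong)
  also have "\<dots> = Poly_Mapping.lookup q m" using m by simp
  finally show False using 0 m by (simp add: in_keys_iff)
qed


section \<open>Generated ideals and saturation\<close>

lemma zero_in_ideal_in: "0 \<in> ideal_in R G"
  unfolding ideal_in_def by (rule CollectI, rule exI[of _ "{}"]) auto

lemma generator_in_ideal_in: "x \<in> G \<Longrightarrow> x \<in> ideal_in (polys_in V) G"
  unfolding ideal_in_def by (rule CollectI, rule exI[of _ "{x}"], rule exI[of _ "\<lambda>_. 1"]) auto

lemma ideal_in_add:
  assumes "x \<in> ideal_in (polys_in V) G" "y \<in> ideal_in (polys_in V) G"
  shows "x + y \<in> ideal_in (polys_in V) G"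
proof -
  obtain F c where F: "finite F" "F \<subseteq> G" "\<forall>g\<in>F. c g \<in> polys_in V" "x = (\<Sum>g\<in>F. c g * g)"
    using assms(1) unfolding ideal_in_def by auto
  obtain F' c' where F': "finite F'" "F' \<subseteq> G" "\<forall>g\<in>F'. c' g \<in> polys_in V" "y = (\<Sum>g\<in>F'. c' g * g)"
    using assms(2) unfolding ideal_in_def by auto
  define d where "d g = (if g \<in> F then c g else 0)" for g
  define d' where "d' g = (if g \<in> F' then c' g else 0)" for g
  have "x = (\<Sum>g\<in>F \<union> F'. d g * g)"
    unfolding F(4) d_def using F F' by (intro sum.mono_neutral_cong_left) auto
  moreover have "y = (\<Sum>g\<in>F \<union> F'. d' g * g)"
    unfolding F'(4) d'_def using F F' by (intro sum.mono_neutral_cong_left) auto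
  ultimately have "x + y = (\<Sum>g\<in>F \<union> F'. (d g + d' g) * g)"
    by (simp add: distrib_right sum.distrib)
  moreover have "\<forall>g\<in>F \<union> F'. d g + d' g \<in> polys_in V"
    using F F' by (auto simp: d_def d'_def intro: polys_in_add)
  moreover have "finite (F \<union> F')" "F \<union> F' \<subseteq> G" using F F' by auto
  ultimately show ?thesis unfolding ideal_in_def
    by (intro CollectI exI[of _ "F \<union> F'"] exI[of _ "\<lambda>g. d g + d' g"]) auto
qed

lemma ideal_in_mult:
  assumes "x \<in> ideal_in (polys_in V) G" "z \<in> polys_in V"
  shows "z * x \<in> ideal_in (polys_in V) G"
proof -
  obtain F c where F: "finite F" "F \<subseteq> G" "\<forall>g\<in>F. c g \<in> polys_in V" "x = (\<Sum>g\<in>F. c g * g)"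
    using assms(1) unfolding ideal_in_def by auto
  have "z * x = (\<Sum>g\<in>F. (z * c g) * g)"
    unfolding F(4) by (simp add: sum_distrib_left mult.assoc)
  moreover have "\<forall>g\<in>F. z * c g \<in> polys_in V"
    using F assms(2) by (auto intro: polys_in_mult)
  ultimately show ?thesis unfolding ideal_in_def using F(1,2)
    by (intro CollectI exI[of _ F] exI[of _ "\<lambda>g. z * c g"]) auto
qed

lemma ideal_in_sum:
  "(\<And>i. i \<in> A \<Longrightarrow> x i \<in> ideal_in (polys_in V) G) \<Longrightarrow> (\<Sum>i\<in>A. x i) \<in> ideal_in (polys_in V) G"
  by (induction A rule: infinite_finite_induct) (auto intro: ideal_in_add zero_in_ideal_in)

text \<open>The multipliers that the saturation by \<open>H\<close> admits.\<close>

definition power_products :: "'r::comm_ring_1 set \<Rightarrow> 'r set" where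
  "power_products H = {(\<Prod>h\<in>F. h ^ (n h :: nat)) | F n. finite F \<and> F \<subseteq> H}"

lemma one_in_power_products: "1 \<in> power_products H"
  unfolding power_products_def by (rule CollectI, rule exI[of _ "{}"]) auto

lemma in_power_products: "h \<in> H \<Longrightarrow> h \<in> power_products H"
  unfolding power_products_def
  by (rule CollectI, rule exI[of _ "{h}"], rule exI[of _ "\<lambda>_. 1"]) auto

lemma power_products_mult:
  assumes "x \<in> power_products H" "y \<in> power_products H"
  shows "x * y \<in> power_products H"
proof -
  obtain F n where F: "finite F" "F \<subseteq> H" "x = (\<Prod>h\<in>F. h ^ (n h :: nat))"
    using assms(1) unfolding power_products_def by auto
  obtain F' n' where F': "finite F'" "F' \<subseteq> H" "y = (\<Prod>h\<in>F'. h ^ (n' h :: nat))"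
    using assms(2) unfolding power_products_def by auto
  define d where "d h = (if h \<in> F then n h else 0)" for h
  define d' where "d' h = (if h \<in> F' then n' h else 0)" for h
  have "x = (\<Prod>h\<in>F \<union> F'. h ^ d h)"
    unfolding F(3) d_def using F F' by (intro prod.mono_neutral_cong_left) auto
  moreover have "y = (\<Prod>h\<in>F \<union> F'. h ^ d' h)"
    unfolding F'(3) d'_def using F F' by (intro prod.mono_neutral_cong_left) auto
  ultimately have "x * y = (\<Prod>h\<in>F \<union> F'. h ^ (d h + d' h))"
    by (simp add: power_add prod.distrib)
  moreover have "finite (F \<union> F')" "F \<union> F' \<subseteq> H" using F F' by auto
  ultimately show ?thesis
    unfolding power_products_def by (intro CollectI exI[of _ "F \<union> F'"] exI[of _ "\<lambda>h. d h + d' h"]) auto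
qed

lemma power_products_power: "x \<in> power_products H \<Longrightarrow> x ^ n \<in> power_products H"
  by (induction n) (auto intro: power_products_mult one_in_power_products)

lemma saturation_inI:
  "g \<in> R \<Longrightarrow> h \<in> power_products H \<Longrightarrow> h * g \<in> J \<Longrightarrow> g \<in> saturation_in R J H"
  unfolding power_products_def saturation_in_def by blast


section \<open>Elimination of variables\<close>

text \<open>Polynomials are measured by bounding the degree in each variable separately: in this form the
  monomials within a bound are counted by a product, and a bound of \<open>0\<close> says that a variable is absent.\<close>

definition box :: "('v \<Rightarrow> nat) \<Rightarrow> ('v, 'a::comm_ring_1) mpoly set" where
  "box \<delta> = {q. \<forall>v. deg_in v q \<le> \<delta> v}"

lemma box_mono: "q \<in> box \<delta> \<Longrightarrow> (\<And>v. \<delta> v \<le> \<epsilon> v) \<Longrightarrow> q \<in> box \<epsilon>"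
  unfolding box_def by (auto intro: order_trans)

lemma box_imp_polys_in: "q \<in> box \<delta> \<Longrightarrow> (\<And>v. v \<notin> V \<Longrightarrow> \<delta> v = 0) \<Longrightarrow> q \<in> polys_in V"
  unfolding box_def polys_in_iff by (metis (lifting) le_zero_eq mem_Collect_eq)

lemma zero_in_box [simp]: "0 \<in> box \<delta>"
  by (simp add: box_def)

lemma box_add: "x \<in> box \<delta> \<Longrightarrow> y \<in> box \<delta> \<Longrightarrow> x + y \<in> box \<delta>"
  unfolding box_def by (auto intro!: order_trans[OF deg_in_add_le])

lemma single_in_box: "(\<And>v. Poly_Mapping.lookup m v \<le> \<delta> v) \<Longrightarrow> Poly_Mapping.single m c \<in> box \<delta>"
  unfolding box_def using deg_in_single[of _ m c] by (auto intro: order_trans)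

lemma keys_box: "q \<in> box \<delta> \<Longrightarrow> m \<in> Poly_Mapping.keys q \<Longrightarrow> Poly_Mapping.lookup m v \<le> \<delta> v"
  using deg_in_le_iff[of v q "\<delta> v"] by (simp add: box_def)

lemma divide_by_variable_power:
  assumes "q \<in> box \<delta>"
  obtains x y where "q = pvar v ^ \<mu> * x + y" "x \<in> box (\<delta>(v := \<delta> v - \<mu>))" "y \<in> box (\<delta>(v := \<mu> - 1))"
proof -
  have "\<exists>x y. q = pvar v ^ \<mu> * x + y \<and> x \<in> box (\<delta>(v := \<delta> v - \<mu>)) \<and> y \<in> box (\<delta>(v := \<mu> - 1))"
  proof (induction q rule: mpoly_induct)
    case zero
    show ?case by (rule exI[of _ 0], rule exI[of _ 0]) simp
  next
    case (add p q)
    then obtain x y x' y' where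
      "p = pvar v ^ \<mu> * x + y" "x \<in> box (\<delta>(v := \<delta> v - \<mu>))" "y \<in> box (\<delta>(v := \<mu> - 1))"
      "q = pvar v ^ \<mu> * x' + y'" "x' \<in> box (\<delta>(v := \<delta> v - \<mu>))" "y' \<in> box (\<delta>(v := \<mu> - 1))"
      by blast
    then have "p + q = pvar v ^ \<mu> * (x + x') + (y + y')"
      "x + x' \<in> box (\<delta>(v := \<delta> v - \<mu>))" "y + y' \<in> box (\<delta>(v := \<mu> - 1))"
      by (auto simp: distrib_left simp del: fun_upd_apply intro: box_add)
    then show ?case by blast
  next
    case (monomial m c)
    then have m: "Poly_Mapping.lookup m u \<le> \<delta> u" for u
      by (rule keys_box[OF assms])
    show ?case
    proof (cases "\<mu> \<le> Poly_Mapping.lookup m v")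
      case True
      define m' where "m' = m - Poly_Mapping.single v \<mu>"
      have m': "Poly_Mapping.lookup m' u = Poly_Mapping.lookup m u - (if u = v then \<mu> else 0)" for u
        by (simp add: m'_def minus_poly_mapping.rep_eq lookup_single when_def)
      have "m = Poly_Mapping.single v \<mu> + m'"
        using True by (intro poly_mapping_eqI) (auto simp: lookup_add m' lookup_single when_def)
      then have "Poly_Mapping.single m c = pvar v ^ \<mu> * Poly_Mapping.single m' c"
        by (simp add: pvar_power mult_single)
      moreover have "Poly_Mapping.single m' c \<in> box (\<delta>(v := \<delta> v - \<mu>))"
        using m by (intro single_in_box) (auto simp: m' diff_le_mono)
      ultimately show ?thesis using zero_in_box add_0_right by metis
    next
      case False
      then have "Poly_Mapping.single m c \<in> box (\<delta>(v := \<mu> - 1))"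
        using m by (intro single_in_box) auto
      then show ?thesis using zero_in_box mult_zero_right add_0_left by metis
    qed
  qed
  then show ?thesis using that by blast
qed

text \<open>Writing \<open>q = v\<^sup>\<mu> x + y\<close> with \<open>deg\<^sub>v y < \<mu>\<close>, one has \<open>h q \<equiv> t x + h y\<close>, which has smaller degree
  in \<open>v\<close> as long as \<open>q\<close> has degree at least \<open>\<mu>\<close>. Thus \<open>n\<close> multiplications by \<open>h\<close> suffice when \<open>n\<close>
  bounds the degree of \<open>q\<close> in \<open>v\<close>, and each adds at most \<open>\<gamma>\<close> to the other degrees. The exponent \<open>n\<close>
  depends on the bound only and not on \<open>q\<close>, so that one multiplier serves all polynomials in a box.\<close>

lemma eliminate_variable:
  fixes h t :: "('v, 'a::comm_ring_1) mpoly"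
  assumes relation: "h * pvar v ^ \<mu> - t \<in> ideal_in (polys_in V) G"
    and h: "h \<in> polys_in V" "v \<notin> vars h" "\<And>u. deg_in u h \<le> \<gamma> u"
    and t: "deg_in v t < \<mu>" "\<And>u. u \<noteq> v \<Longrightarrow> deg_in u t \<le> \<gamma> u"
    and "v \<in> V" and \<gamma>: "\<And>u. u \<notin> V \<Longrightarrow> \<gamma> u = 0"
    and "\<And>u. u \<notin> V \<Longrightarrow> \<delta> u = 0" and "\<delta> v \<le> n" and "q \<in> box \<delta>"
  shows "\<exists>q' \<in> box ((\<lambda>u. \<delta> u + n * \<gamma> u)(v := \<mu> - 1)). h ^ n * q - q' \<in> ideal_in (polys_in V) G"
  using assms(9-11)
proof (induction n arbitrary: \<delta> q)
  case 0
  have "q \<in> box ((\<lambda>u. \<delta> u + 0 * \<gamma> u)(v := \<mu> - 1))"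
    by (rule box_mono[OF 0(3)]) (use 0(2) in simp)
  then show ?case by (intro bexI[of _ q]) (simp_all add: zero_in_ideal_in del: fun_upd_apply)
next
  case (Suc n)
  show ?case
  proof (cases "\<delta> v < \<mu>")
    case True
    have "h ^ Suc n * q \<in> box ((\<lambda>u. \<delta> u + Suc n * \<gamma> u)(v := \<mu> - 1))"
      unfolding box_def
    proof (intro CollectI allI)
      fix u
      have "deg_in u (h ^ Suc n * q) \<le> Suc n * deg_in u h + deg_in u q"
        using deg_in_mult_le[of u "h ^ Suc n" q] deg_in_power_le[of u h "Suc n"] by linarith
      moreover have "Suc n * deg_in u h \<le> Suc n * \<gamma> u" using h(3) by (intro mult_le_mono) auto
      moreover have "deg_in u q \<le> \<delta> u" using Suc.prems(3) by (simp add: box_def)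
      moreover have "deg_in v h = 0" using h(2) by (simp add: deg_in_eq_0_iff)
      ultimately show "deg_in u (h ^ Suc n * q) \<le> ((\<lambda>u. \<delta> u + Suc n * \<gamma> u)(v := \<mu> - 1)) u"
        using True by (cases "u = v") auto
    qed
    then show ?thesis by (intro bexI[of _ "h ^ Suc n * q"]) (simp_all add: zero_in_ideal_in del: fun_upd_apply)
  next
    case False
    obtain x y where q: "q = pvar v ^ \<mu> * x + y" and
      x: "x \<in> box (\<delta>(v := \<delta> v - \<mu>))" and y: "y \<in> box (\<delta>(v := \<mu> - 1))"
      using divide_by_variable_power[OF Suc.prems(3)] .
    define \<delta>1 where "\<delta>1 = (\<lambda>u. \<delta> u + \<gamma> u)(v := \<delta> v - 1)"
    define q1 where "q1 = t * x + h * y"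
    have x_deg: "deg_in u x \<le> (\<delta>(v := \<delta> v - \<mu>)) u" for u
      using x unfolding box_def by blast
    have y_deg: "deg_in u y \<le> (\<delta>(v := \<mu> - 1)) u" for u
      using y unfolding box_def by blast
    have "deg_in u q1 \<le> \<delta>1 u" for u
    proof (cases "u = v")
      case True
      have "deg_in v (t * x) \<le> \<delta> v - 1"
        using deg_in_mult_le[of v t x] x_deg[of v] t(1) False by simp
      moreover have "deg_in v (h * y) \<le> \<delta> v - 1"
        using deg_in_mult_le[of v h y] y_deg[of v] h(2) False by (simp add: deg_in_eq_0_iff[symmetric])
      ultimately show ?thesis
        unfolding q1_def \<delta>1_def using deg_in_add_le[of v "t * x" "h * y"] True by simp
    next
      case False
      have "deg_in u (t * x) \<le> \<delta> u + \<gamma> u"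
        using deg_in_mult_le[of u t x] x_deg[of u] t(2)[of u] False by simp
      moreover have "deg_in u (h * y) \<le> \<delta> u + \<gamma> u"
        using deg_in_mult_le[of u h y] y_deg[of u] h(3)[of u] False by simp
      ultimately show ?thesis
        unfolding q1_def \<delta>1_def using deg_in_add_le[of u "t * x" "h * y"] False by simp
    qed
    then have "q1 \<in> box \<delta>1" by (simp add: box_def)
    moreover have "\<delta>1 v \<le> n" using Suc.prems(2) by (simp add: \<delta>1_def)
    moreover have "\<delta>1 u = 0" if "u \<notin> V" for u
      using that Suc.prems(1) \<gamma> \<open>v \<in> V\<close> by (auto simp: \<delta>1_def)
    ultimately obtain q' where q': "q' \<in> box ((\<lambda>u. \<delta>1 u + n * \<gamma> u)(v := \<mu> - 1))"
      "h ^ n * q1 - q' \<in> ideal_in (polys_in V) G"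
      using Suc.IH by blast
    have "x \<in> polys_in V" using x
      by (rule box_imp_polys_in) (use Suc.prems(1) \<open>v \<in> V\<close> in auto)
    then have "h ^ n * (x * (h * pvar v ^ \<mu> - t)) \<in> ideal_in (polys_in V) G"
      using relation h(1) by (intro ideal_in_mult polys_in_power)
    from ideal_in_add[OF this q'(2)]
    have "h ^ Suc n * q - q' \<in> ideal_in (polys_in V) G"
      by (simp add: q q1_def algebra_simps)
    moreover have "q' \<in> box ((\<lambda>u. \<delta> u + Suc n * \<gamma> u)(v := \<mu> - 1))"
      using q'(1) by (rule box_mono) (simp add: \<delta>1_def)
    ultimately show ?thesis by blast
  qed
qed

text \<open>Variables are eliminated in the order of increasing \<open>rk\<close>. Since \<open>h v\<close> and \<open>t v\<close> contain no variable
  of \<open>E\<close> of rank at most that of \<open>v\<close>, apart from \<open>v\<close> itself, eliminating \<open>v\<close> leaves intact the bounds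
  already reached for the variables before it. It is essential that \<open>c\<close> is chosen before \<open>d\<close>: the
  degrees in the remaining variables grow only linearly.\<close>

lemma eliminate_variables:
  fixes h t :: "'v \<Rightarrow> ('v, 'a::comm_ring_1) mpoly" and rk :: "'v \<Rightarrow> nat"
  assumes "finite V" and "E \<subseteq> V"
    and relation: "\<And>v. v \<in> E \<Longrightarrow> h v * pvar v ^ \<mu> v - t v \<in> ideal_in (polys_in V) G"
    and h: "\<And>v. v \<in> E \<Longrightarrow> h v \<in> H" "\<And>v. v \<in> E \<Longrightarrow> h v \<in> polys_in V" "\<And>v. v \<in> E \<Longrightarrow> v \<notin> vars (h v)"
    and t: "\<And>v. v \<in> E \<Longrightarrow> t v \<in> polys_in V" "\<And>v. v \<in> E \<Longrightarrow> deg_in v (t v) < \<mu> v"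
    and rk: "\<And>v u. v \<in> E \<Longrightarrow> u \<in> E \<Longrightarrow> u \<in> vars (h v) \<union> vars (t v) \<Longrightarrow> u \<noteq> v \<Longrightarrow> rk v < rk u"
  shows "\<exists>c. \<forall>d. \<exists>g \<in> power_products H. \<forall>q \<in> box (\<lambda>v. if v \<in> V then d else 0).
           \<exists>q' \<in> box (\<lambda>v. if v \<in> E then \<mu> v - 1 else if v \<in> V then c * d else 0).
             g * q - q' \<in> ideal_in (polys_in V) G"
proof -
  have "finite E" using assms(1,2) finite_subset by blast
  then show ?thesis using assms(2-)
  proof (induction E rule: finite_ranking_induct[where f = rk])
    case empty
    have "\<exists>q' \<in> box (\<lambda>v. if v \<in> {} then \<mu> v - 1 else if v \<in> V then 1 * d else 0).
        1 * q - q' \<in> ideal_in (polys_in V) G"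
      if "q \<in> box (\<lambda>v. if v \<in> V then d else 0)" for q d
    proof (rule bexI[of _ q])
      show "q \<in> box (\<lambda>v. if v \<in> {} then \<mu> v - 1 else if v \<in> V then 1 * d else 0)"
        using that by (rule box_mono) simp
    qed (simp add: zero_in_ideal_in)
    then show ?case using one_in_power_products by blast
  next
    case (insert v E)
    show ?case
    proof (cases "v \<in> E")
      case True
      then show ?thesis using insert by (simp add: insert_absorb)
    next
      case False
      have "\<exists>c. \<forall>d. \<exists>g \<in> power_products H. \<forall>q \<in> box (\<lambda>v. if v \<in> V then d else 0).
           \<exists>q' \<in> box (\<lambda>v. if v \<in> E then \<mu> v - 1 else if v \<in> V then c * d else 0).
             g * q - q' \<in> ideal_in (polys_in V) G"
        by (rule insert.IH) (use insert.prems in auto)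
      then obtain c where c: "\<And>d. \<exists>g \<in> power_products H. \<forall>q \<in> box (\<lambda>v. if v \<in> V then d else 0).
           \<exists>q' \<in> box (\<lambda>v. if v \<in> E then \<mu> v - 1 else if v \<in> V then c * d else 0).
             g * q - q' \<in> ideal_in (polys_in V) G"
        by blast
      have "v \<in> V" using insert.prems(1) by simp
      define \<gamma> where "\<gamma> u = (if u = v then 0 else max (deg_in u (h v)) (deg_in u (t v)))" for u
      define c' where "c' = (\<Sum>u\<in>V. \<gamma> u)"
      have \<gamma>_le: "\<gamma> u \<le> c'" if "u \<in> V" for u
        unfolding c'_def using that \<open>finite V\<close> by (simp add: member_le_sum)
      have \<gamma>_V: "\<gamma> u = 0" if "u \<notin> V" for u
        using insert.prems(4,6) that by (simp add: \<gamma>_def polys_in_iff)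
      \<comment> \<open>The variables eliminated before have rank at most that of \<open>v\<close> and do not reappear.\<close>
      have \<gamma>_E: "\<gamma> u = 0" if "u \<in> E" for u
      proof -
        have "u \<noteq> v" "rk u \<le> rk v" using that False insert.hyps by auto
        then have "u \<notin> vars (h v) \<union> vars (t v)"
          using insert.prems(8)[of v u] that by auto
        then show ?thesis by (simp add: \<gamma>_def deg_in_eq_0_iff)
      qed
      show ?thesis
      proof (intro exI[of _ "c + c * c'"] allI)
        fix d
        define \<delta> where "\<delta> = (\<lambda>u. if u \<in> E then \<mu> u - 1 else if u \<in> V then c * d else 0)"
        define \<delta>' where "\<delta>' = (\<lambda>u. if u \<in> insert v E then \<mu> u - 1
                             else if u \<in> V then (c + c * c') * d else 0)"
        obtain g where g: "g \<in> power_products H"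
          "\<And>q. q \<in> box (\<lambda>v. if v \<in> V then d else 0) \<Longrightarrow>
             \<exists>q' \<in> box \<delta>. g * q - q' \<in> ideal_in (polys_in V) G"
          using c[of d] unfolding \<delta>_def by blast
        have "\<exists>q' \<in> box \<delta>'. (h v ^ (c * d) * g) * q - q' \<in> ideal_in (polys_in V) G"
          if q: "q \<in> box (\<lambda>v. if v \<in> V then d else 0)" for q
        proof -
          obtain q1 where q1: "q1 \<in> box \<delta>" "g * q - q1 \<in> ideal_in (polys_in V) G"
            using g(2)[OF q] by blast
          have "\<exists>q' \<in> box ((\<lambda>u. \<delta> u + (c * d) * \<gamma> u)(v := \<mu> v - 1)).
                  h v ^ (c * d) * q1 - q' \<in> ideal_in (polys_in V) G"
          proof (rule eliminate_variable[where t = "t v"])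
            show "deg_in u (h v) \<le> \<gamma> u" for u
              using insert.prems(5)[of v] by (simp add: \<gamma>_def deg_in_eq_0_iff)
            show "deg_in u (t v) \<le> \<gamma> u" if "u \<noteq> v" for u
              using that by (simp add: \<gamma>_def)
            show "\<delta> v \<le> c * d" using False \<open>v \<in> V\<close> by (simp add: \<delta>_def)
            show "\<delta> u = 0" if "u \<notin> V" for u
              using that insert.prems(1) by (auto simp: \<delta>_def)
          qed (use insert.prems q1 \<gamma>_V \<open>v \<in> V\<close> in auto)
          then obtain q' where q': "q' \<in> box ((\<lambda>u. \<delta> u + (c * d) * \<gamma> u)(v := \<mu> v - 1))"
              "h v ^ (c * d) * q1 - q' \<in> ideal_in (polys_in V) G"
            by blast
          have "h v ^ (c * d) * (g * q - q1) + (h v ^ (c * d) * q1 - q') \<in> ideal_in (polys_in V) G"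
            using q1(2) q'(2) insert.prems(4) by (intro ideal_in_add ideal_in_mult polys_in_power) auto
          then have "(h v ^ (c * d) * g) * q - q' \<in> ideal_in (polys_in V) G"
            by (simp add: algebra_simps)
          moreover have "q' \<in> box \<delta>'"
          proof (rule box_mono[OF q'(1)])
            fix u
            have "c * d + c * d * \<gamma> u \<le> (c + c * c') * d" if "u \<in> V"
              using mult_le_mono2[OF \<gamma>_le[OF that], of "c * d"] by (simp add: algebra_simps)
            then show "((\<lambda>u. \<delta> u + c * d * \<gamma> u)(v := \<mu> v - 1)) u \<le> \<delta>' u"
              using \<gamma>_E[of u] \<gamma>_V[of u] by (auto simp: \<delta>_def \<delta>'_def)
          qed
          ultimately show ?thesis by blast
        qed
        moreover have "h v ^ (c * d) * g \<in> power_products H"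
          using insert.prems(3)
          by (intro power_products_mult power_products_power g(1)) (simp add: in_power_products)
        ultimately show "\<exists>g \<in> power_products H. \<forall>q \<in> box (\<lambda>v. if v \<in> V then d else 0).
            \<exists>q' \<in> box (\<lambda>u. if u \<in> insert v E then \<mu> u - 1
                             else if u \<in> V then (c + c * c') * d else 0).
              g * q - q' \<in> ideal_in (polys_in V) G"
          unfolding \<delta>'_def by blast
      qed
    qed
  qed
qed


section \<open>Counting monomials\<close>

text \<open>A homogeneous linear system with more unknowns than equations, solved by Gaussian elimination.\<close>

lemma nontrivial_linear_relation:
  fixes A :: "'t \<Rightarrow> 's \<Rightarrow> 'a::field"
  assumes "finite T" "card T < card S"
  shows "\<exists>c. (\<exists>s\<in>S. c s \<noteq> 0) \<and> (\<forall>t\<in>T. (\<Sum>s\<in>S. A t s * c s) = 0)"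
  using assms
proof (induction T arbitrary: S A rule: finite_induct)
  case empty
  then have "S \<noteq> {}" by auto
  then show ?case by (intro exI[of _ "\<lambda>_. 1"]) auto
next
  case (insert t T)
  then have "finite S" by (metis card.infinite not_less_zero)
  show ?case
  proof (cases "\<forall>s\<in>S. A t s = 0")
    case True
    have "card T < card S" using insert by simp
    from insert.IH[OF this, of A] True show ?thesis by auto
  next
    case False
    then obtain s0 where s0: "s0 \<in> S" "A t s0 \<noteq> 0" by blast
    \<comment> \<open>Equation \<open>t\<close> is solved for the unknown \<open>s0\<close>, which is then substituted in the others.\<close>
    define S' where "S' = S - {s0}"
    have "card T < card S'" using insert s0 \<open>finite S\<close> by (simp add: S'_def)
    from insert.IH[OF this, of "\<lambda>t' s. A t' s - A t' s0 * A t s / A t s0"]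
    obtain c where c: "\<exists>s\<in>S'. c s \<noteq> 0"
      "\<And>t'. t' \<in> T \<Longrightarrow> (\<Sum>s\<in>S'. (A t' s - A t' s0 * A t s / A t s0) * c s) = 0"
      by blast
    define c0 where "c0 = - (\<Sum>s\<in>S'. A t s * c s) / A t s0"
    have split: "(\<Sum>s\<in>S. A t' s * (c(s0 := c0)) s) = A t' s0 * c0 + (\<Sum>s\<in>S'. A t' s * c s)" for t'
      unfolding S'_def using s0(1) \<open>finite S\<close> by (subst sum.remove[of _ s0]) auto
    have "(\<Sum>s\<in>S. A t' s * (c(s0 := c0)) s) = 0" if "t' \<in> insert t T" for t'
    proof (cases "t' = t")
      case True
      have "A t s0 * c0 = - (\<Sum>s\<in>S'. A t s * c s)" using s0(2) by (simp add: c0_def)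
      then show ?thesis unfolding True split by simp
    next
      case False
      have "A t' s0 * c0 + (\<Sum>s\<in>S'. A t' s * c s) =
          (\<Sum>s\<in>S'. (A t' s - A t' s0 * A t s / A t s0) * c s)"
        by (simp add: c0_def left_diff_distrib sum_subtractf sum_distrib_left sum_divide_distrib
              mult.assoc sum_negf[symmetric])
      then show ?thesis using c(2)[of t'] False that split by simp
    qed
    moreover have "\<exists>s\<in>S. (c(s0 := c0)) s \<noteq> 0" using c(1) by (auto simp: S'_def)
    ultimately show ?thesis by blast
  qed
qed

lemma card_box_monomials:
  assumes "finite V" "\<And>v. v \<notin> V \<Longrightarrow> \<delta> v = 0"
  shows "finite {m :: 'v \<Rightarrow>\<^sub>0 nat. \<forall>v. Poly_Mapping.lookup m v \<le> \<delta> v}" (is "finite ?B")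
    and "card {m :: 'v \<Rightarrow>\<^sub>0 nat. \<forall>v. Poly_Mapping.lookup m v \<le> \<delta> v} = (\<Prod>v\<in>V. \<delta> v + 1)"
proof -
  have bij: "bij_betw (\<lambda>m. restrict (Poly_Mapping.lookup m) V) ?B (PiE V (\<lambda>v. {..\<delta> v}))"
  proof (rule bij_betw_byWitness[where f' = "\<lambda>f. Abs_poly_mapping (\<lambda>v. if v \<in> V then f v else 0)"])
    have lookup: "Poly_Mapping.lookup (Abs_poly_mapping (\<lambda>v. if v \<in> V then f v else 0)) =
        (\<lambda>v. if v \<in> V then f v else (0::nat))" for f
      using \<open>finite V\<close> by (intro lookup_Abs_poly_mapping) (auto elim: finite_subset[rotated])
    have "Poly_Mapping.lookup m v = 0" if "m \<in> ?B" "v \<notin> V" for m v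
      using that assms(2)[of v] by (metis (mono_tags, lifting) le_zero_eq mem_Collect_eq)
    then show "\<forall>m\<in>?B. Abs_poly_mapping (\<lambda>v. if v \<in> V then restrict (Poly_Mapping.lookup m) V v else 0) = m"
      by (auto intro!: poly_mapping_eqI simp: lookup)
    show "\<forall>f\<in>PiE V (\<lambda>v. {..\<delta> v}).
        restrict (Poly_Mapping.lookup (Abs_poly_mapping (\<lambda>v. if v \<in> V then f v else 0))) V = f"
      by (auto simp: lookup PiE_def extensional_def fun_eq_iff)
    show "(\<lambda>m. restrict (Poly_Mapping.lookup m) V) ` ?B \<subseteq> PiE V (\<lambda>v. {..\<delta> v})"
      by auto
    show "(\<lambda>f. Abs_poly_mapping (\<lambda>v. if v \<in> V then f v else 0)) ` PiE V (\<lambda>v. {..\<delta> v}) \<subseteq> ?B"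
      using assms(2) by (auto simp: lookup PiE_def Pi_def)
  qed
  have "finite (PiE V (\<lambda>v. {..\<delta> v}))" "card (PiE V (\<lambda>v. {..\<delta> v})) = (\<Prod>v\<in>V. \<delta> v + 1)"
    using \<open>finite V\<close> by (auto simp: card_PiE intro: finite_PiE)
  then show "finite ?B" "card ?B = (\<Prod>v\<in>V. \<delta> v + 1)"
    using bij_betw_finite[OF bij] bij_betw_same_card[OF bij] by simp_all
qed

lemma lookup_pconst_mult: "Poly_Mapping.lookup (pconst c * q) m = c * Poly_Mapping.lookup q m"
proof -
  have "pconst c * q = Poly_Mapping.map ((*) c) q"
    by (simp add: pconst_def mult_map_scale_conv_mult)
  then show ?thesis by (simp add: Poly_Mapping.map.rep_eq when_def)
qed

text \<open>This plays the part of the statement that \<open>card (V - X)\<close> generators bound the transcendence degree,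
  for a quotient that need not be a domain: the variables of \<open>X\<close> are algebraic over those of \<open>V - X\<close>
  once the \<open>h v\<close> are inverted, so more than \<open>card (V - X)\<close> variables \<open>Y\<close> are dependent. The number of
  monomials in \<open>Y\<close> with exponents at most \<open>d\<close> grows like a higher power of \<open>d\<close> than that of the normal
  forms available for them.\<close>

lemma elimination_dependence:
  fixes h t :: "'v \<Rightarrow> ('v, 'a::field) mpoly" and rk :: "'v \<Rightarrow> nat"
  assumes "finite V" and "X \<subseteq> V" and "Y \<subseteq> V" and "card (V - X) < card Y"
    and relation: "\<And>v. v \<in> X \<Longrightarrow> h v * pvar v ^ \<mu> v - t v \<in> ideal_in (polys_in V) G"
    and h: "\<And>v. v \<in> X \<Longrightarrow> h v \<in> H" "\<And>v. v \<in> X \<Longrightarrow> h v \<in> polys_in V" "\<And>v. v \<in> X \<Longrightarrow> v \<notin> vars (h v)"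
    and t: "\<And>v. v \<in> X \<Longrightarrow> t v \<in> polys_in V" "\<And>v. v \<in> X \<Longrightarrow> deg_in v (t v) < \<mu> v"
    and rk: "\<And>v u. v \<in> X \<Longrightarrow> u \<in> X \<Longrightarrow> u \<in> vars (h v) \<union> vars (t v) \<Longrightarrow> u \<noteq> v \<Longrightarrow> rk v < rk u"
  shows "\<exists>q \<in> polys_in Y. q \<noteq> 0 \<and> q \<in> saturation_in (polys_in V) (ideal_in (polys_in V) G) H"
proof -
  define k where "k = card (V - X)"
  define C where "C = (\<Prod>v\<in>X. \<mu> v)"
  obtain c where c: "\<forall>d. \<exists>g \<in> power_products H. \<forall>q \<in> box (\<lambda>v. if v \<in> V then d else 0).
           \<exists>q' \<in> box (\<lambda>v. if v \<in> X then \<mu> v - 1 else if v \<in> V then c * d else 0).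
             g * q - q' \<in> ideal_in (polys_in V) G"
    using eliminate_variables[OF assms(1,2,5-11)] ..
  \<comment> \<open>This \<open>d\<close> makes \<open>C (c d + 1)\<^sup>k \<le> C (c + 1)\<^sup>k (d + 1)\<^sup>k = d (d + 1)\<^sup>k < (d + 1)\<^sup>k\<^sup>+\<^sup>1\<close>.\<close>
  define d where "d = C * (c + 1) ^ k"
  define \<epsilon> where "\<epsilon> = (\<lambda>v. if v \<in> X then \<mu> v - 1 else if v \<in> V then c * d else 0)"
  obtain g where g: "g \<in> power_products H" "\<And>q. q \<in> box (\<lambda>v. if v \<in> V then d else 0) \<Longrightarrow>
      \<exists>q' \<in> box \<epsilon>. g * q - q' \<in> ideal_in (polys_in V) G"
    using spec[OF c, of d] unfolding \<epsilon>_def by blast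
  define S where "S = {m :: 'v \<Rightarrow>\<^sub>0 nat. \<forall>v. Poly_Mapping.lookup m v \<le> (if v \<in> Y then d else 0)}"
  define T where "T = {m :: 'v \<Rightarrow>\<^sub>0 nat. \<forall>v. Poly_Mapping.lookup m v \<le> \<epsilon> v}"
  have fin: "finite X" "finite Y" "finite (V - X)"
    using assms(1-3) finite_subset by auto
  have "\<epsilon> v = 0" if "v \<notin> V" for v
    using that assms(2) by (auto simp: \<epsilon>_def)
  then have T: "finite T" "card T = (\<Prod>v\<in>V. \<epsilon> v + 1)"
    unfolding T_def using card_box_monomials[of V \<epsilon>] assms(1) by auto
  have "(\<Prod>v\<in>V. \<epsilon> v + 1) = (\<Prod>v\<in>X. \<epsilon> v + 1) * (\<Prod>v\<in>V - X. \<epsilon> v + 1)"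
    using assms(1,2) by (simp add: prod.subset_diff mult.commute)
  also have "(\<Prod>v\<in>X. \<epsilon> v + 1) = C"
    unfolding C_def
  proof (intro prod.cong refl)
    fix v assume "v \<in> X"
    then show "\<epsilon> v + 1 = \<mu> v" using t(2)[of v] by (simp add: \<epsilon>_def)
  qed
  also have "(\<Prod>v\<in>V - X. \<epsilon> v + 1) = (c * d + 1) ^ k"
    by (simp add: \<epsilon>_def k_def)
  finally have card_T: "card T = C * (c * d + 1) ^ k" using T(2) by simp
  have card_S: "card S = (d + 1) ^ card Y"
    unfolding S_def using card_box_monomials(2)[of Y "\<lambda>v. if v \<in> Y then d else 0"] fin by simp
  have "C * (c * d + 1) ^ k \<le> C * ((c + 1) * (d + 1)) ^ k"
    by (intro mult_le_mono2 power_mono) auto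
  also have "\<dots> = d * (d + 1) ^ k"
    by (simp only: d_def power_mult_distrib mult.assoc)
  also have "\<dots> < (d + 1) ^ Suc k"
    by simp
  also have "\<dots> \<le> (d + 1) ^ card Y"
    using assms(4) by (intro power_increasing) (auto simp: k_def)
  finally have "card T < card S" by (simp add: card_T card_S)
  have "\<exists>q' \<in> box \<epsilon>. g * Poly_Mapping.single m 1 - q' \<in> ideal_in (polys_in V) G" if "m \<in> S" for m
  proof (rule g(2), rule single_in_box)
    fix v
    have "Poly_Mapping.lookup m v \<le> (if v \<in> Y then d else 0)"
      using that by (simp add: S_def)
    also have "\<dots> \<le> (if v \<in> V then d else 0)"
      using assms(3) by auto
    finally show "Poly_Mapping.lookup m v \<le> (if v \<in> V then d else 0)" .
  qed
  then obtain nf where nf: "\<And>m. m \<in> S \<Longrightarrow> nf m \<in> box \<epsilon>"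
    "\<And>m. m \<in> S \<Longrightarrow> g * Poly_Mapping.single m 1 - nf m \<in> ideal_in (polys_in V) G"
    by metis
  obtain a where a: "\<exists>m\<in>S. a m \<noteq> 0" "\<And>n. n \<in> T \<Longrightarrow> (\<Sum>m\<in>S. Poly_Mapping.lookup (nf m) n * a m) = 0"
    using nontrivial_linear_relation[OF T(1) \<open>card T < card S\<close>, of "\<lambda>n m. Poly_Mapping.lookup (nf m) n"]
    by blast
  \<comment> \<open>The normal forms cancel in the combination with coefficients \<open>a\<close>, so \<open>g q\<close> lies in the ideal.\<close>
  define q where "q = (\<Sum>m\<in>S. Poly_Mapping.single m (a m))"
  have "finite S" using \<open>card T < card S\<close> by (metis card.infinite not_less_zero)
  have "Poly_Mapping.lookup q m = a m" if "m \<in> S" for m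
    using that \<open>finite S\<close> by (simp add: q_def lookup_sum lookup_single when_def)
  then have "q \<noteq> 0" using a(1) by auto
  have q: "q \<in> polys_in Y"
    unfolding q_def
  proof (rule polys_in_sum)
    fix m assume "m \<in> S"
    then have "Poly_Mapping.single m (a m) \<in> box (\<lambda>v. if v \<in> Y then d else 0)"
      by (intro single_in_box) (simp add: S_def)
    then show "Poly_Mapping.single m (a m) \<in> polys_in Y"
      by (rule box_imp_polys_in) simp
  qed
  have "(\<Sum>m\<in>S. pconst (a m) * nf m) = 0"
  proof (rule poly_mapping_eqI)
    fix n
    have *: "Poly_Mapping.lookup (\<Sum>m\<in>S. pconst (a m) * nf m) n = (\<Sum>m\<in>S. Poly_Mapping.lookup (nf m) n * a m)"
      by (simp add: lookup_sum lookup_pconst_mult mult.commute[of _ "a _"])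
    show "Poly_Mapping.lookup (\<Sum>m\<in>S. pconst (a m) * nf m) n = Poly_Mapping.lookup 0 n"
    proof (cases "n \<in> T")
      case True
      then show ?thesis using a(2) * by simp
    next
      case False
      then have "n \<notin> Poly_Mapping.keys (nf m)" if "m \<in> S" for m
        using keys_box[OF nf(1)[OF that]] unfolding T_def by blast
      then show ?thesis using * by (simp add: in_keys_iff)
    qed
  qed
  then have "g * q = (\<Sum>m\<in>S. pconst (a m) * (g * Poly_Mapping.single m 1 - nf m))"
    by (simp add: q_def sum_distrib_left right_diff_distrib sum_subtractf pconst_def
          mult.left_commute[of _ g] mult_single)
  also have "\<dots> \<in> ideal_in (polys_in V) G"
  proof (intro ideal_in_sum ideal_in_mult nf(2))
    show "pconst (a m) \<in> polys_in V" for m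
      by (simp add: polys_in_iff deg_in_def pconst_def)
  qed
  finally have "q \<in> saturation_in (polys_in V) (ideal_in (polys_in V) G) H"
    using g(1) q polys_in_mono[OF assms(3)] by (intro saturation_inI[of _ _ g]) auto
  then show ?thesis using q \<open>q \<noteq> 0\<close> by blast
qed


section \<open>The leading parts of a difference polynomial\<close>

lemma vars_coeff_in: "vars (coeff_in v d q) \<subseteq> vars q - {v}"
proof
  fix u assume "u \<in> vars (coeff_in v d q)"
  then obtain n where n: "n \<in> Poly_Mapping.keys (coeff_in v d q)" "u \<in> Poly_Mapping.keys n"
    by (auto simp: vars_def)
  then obtain m where "m \<in> Poly_Mapping.keys q" "n = Poly_Mapping.update v 0 m"
    unfolding coeff_in_def by (auto dest!: subsetD[OF keys_sum] split: if_splits)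
  then show "u \<in> vars q - {v}"
    using n(2) by (auto simp: vars_def in_keys_iff lookup_update split: if_splits)
qed

lemma coeff_in_mult_pvar_power:
  "coeff_in v d q * pvar v ^ d =
     (\<Sum>m | m \<in> Poly_Mapping.keys q \<and> Poly_Mapping.lookup m v = d. Poly_Mapping.single m (Poly_Mapping.lookup q m))"
proof -
  have "Poly_Mapping.update v 0 m + Poly_Mapping.single v d = m" if "Poly_Mapping.lookup m v = d" for m
    using that by (intro poly_mapping_eqI) (auto simp: lookup_add lookup_update lookup_single when_def)
  then show ?thesis
    unfolding coeff_in_def pvar_power sum_distrib_right by (intro sum.cong) (auto simp: mult_single)
qed

text \<open>Multiplying the coefficient of \<open>v\<^sup>d\<close> back by \<open>v\<^sup>d\<close> recovers exactly the monomials of degree \<open>d\<close> in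
  \<open>v\<close>; the initial and the tail of a difference polynomial are understood through this.\<close>

lemma lookup_coeff_in_mult_pvar_power:
  "Poly_Mapping.lookup (coeff_in v d q * pvar v ^ d) m =
     (if Poly_Mapping.lookup m v = d then Poly_Mapping.lookup q m else 0)"
  unfolding coeff_in_mult_pvar_power by (auto simp: lookup_sum lookup_single when_def in_keys_iff)

text \<open>Nonzero constants are units over a field. The maximum that defines the order is thereby taken over a
  nonempty set.\<close>

lemma irreducible_has_variables:
  fixes q :: "('v::linorder, 'a::field) mpoly"
  assumes "irreducible q"
  shows "vars q \<noteq> {}"
proof
  assume "vars q = {}"
  then have zero: "m = 0" if "m \<in> Poly_Mapping.keys q" for m
    using that by (auto simp: vars_def)
  define c where "c = Poly_Mapping.lookup q 0"
  have "q = pconst c"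
  proof (rule poly_mapping_eqI)
    fix m
    show "Poly_Mapping.lookup q m = Poly_Mapping.lookup (pconst c) m"
      using zero[of m] by (cases "m = 0") (auto simp: c_def pconst_def lookup_single when_def in_keys_iff)
  qed
  moreover have "q \<noteq> 0" using assms by auto
  ultimately have "c \<noteq> 0" by (auto simp: pconst_def)
  then have "q * pconst (1 / c) = 1"
    unfolding \<open>q = pconst c\<close> by (simp flip: pconst_mult) (simp add: pconst_def)
  then have "q dvd 1" by (metis dvdI)
  then show False using assms by (simp add: irreducible_def)
qed

context
  fixes q :: "'a::field dpoly"
  assumes has_vars: "vars q \<noteq> {}"
begin

lemma dorder_in_vars: "dorder q \<in> vars q"
  unfolding dorder_def using has_vars by (intro Max_in) auto

lemma vars_le_dorder: "vars q \<subseteq> {..dorder q}"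
  unfolding dorder_def by auto

lemma ddegree_pos: "0 < ddegree q"
  using dorder_in_vars by (simp add: ddegree_def in_vars_iff_deg_in)

lemma initial_nonzero: "initial q \<noteq> 0"
proof
  assume "initial q = 0"
  then have "coeff_in (dorder q) (ddegree q) q * pvar (dorder q) ^ ddegree q = 0"
    by (simp add: initial_def)
  moreover have "q \<noteq> 0" using has_vars by auto
  then obtain m where "m \<in> Poly_Mapping.keys q" "Poly_Mapping.lookup m (dorder q) = ddegree q"
    unfolding ddegree_def by (rule deg_in_attained)
  ultimately show False
    using lookup_coeff_in_mult_pvar_power[of "dorder q" "ddegree q" q m] by (simp add: in_keys_iff)
qed

lemma vars_initial: "vars (initial q) \<subseteq> {..<dorder q}"
  proof
  fix v assume "v \<in> vars (initial q)"
  then have "v \<in> vars q - {dorder q}"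
    using vars_coeff_in[of "dorder q" "ddegree q" q] by (auto simp: initial_def)
  then show "v \<in> {..<dorder q}" using vars_le_dorder by auto
qed

lemma lookup_dtail:
  "Poly_Mapping.lookup (dtail q) m =
     (if Poly_Mapping.lookup m (dorder q) = ddegree q then 0 else Poly_Mapping.lookup q m)"
  by (simp add: dtail_def initial_def lookup_minus lookup_coeff_in_mult_pvar_power)

lemma vars_dtail: "vars (dtail q) \<subseteq> {..dorder q}"
proof -
  have "Poly_Mapping.keys (dtail q) \<subseteq> Poly_Mapping.keys q"
    by (auto simp: in_keys_iff lookup_dtail split: if_splits)
  then have "vars (dtail q) \<subseteq> vars q" by (auto simp: vars_def)
  then show ?thesis using vars_le_dorder by (rule order_trans)
qed

lemma deg_in_dtail: "deg_in (dorder q) (dtail q) < ddegree q"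
proof -
  have "Poly_Mapping.lookup m (dorder q) \<le> ddegree q - 1" if "m \<in> Poly_Mapping.keys (dtail q)" for m
  proof -
    have "m \<in> Poly_Mapping.keys q" "Poly_Mapping.lookup m (dorder q) \<noteq> ddegree q"
      using that by (auto simp: in_keys_iff lookup_dtail split: if_splits)
    then show ?thesis
      using lookup_le_deg_in[of m q "dorder q"] by (simp add: ddegree_def)
  qed
  then have "deg_in (dorder q) (dtail q) \<le> ddegree q - 1" by (simp add: deg_in_le_iff)
  then show ?thesis using ddegree_pos by linarith
qed

end


section \<open>The endomorphism of the difference ring\<close>

definition shift :: "svar \<Rightarrow> svar" where
  "shift v = (case v of W k j \<Rightarrow> W k (Suc j) | Z j \<Rightarrow> Z (Suc j))"

lemma sigma_eq: "sigma = psubst (\<lambda>v. pvar (shift v))"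
  unfolding sigma_def shift_def by (intro arg_cong[of _ _ psubst] ext) (simp split: svar.split)

lemma inj_shift: "inj shift"
  by (auto simp: inj_on_def shift_def split: svar.splits)

lemma shift_iterate_W: "(shift ^^ j) (W k i) = W k (i + j)"
  by (induction j) (simp_all add: shift_def)

lemma shift_iterate_Z: "(shift ^^ j) (Z i) = Z (i + j)"
  by (induction j) (simp_all add: shift_def)

lemma vars_sigma_iterate: "vars ((sigma ^^ j) q) \<subseteq> (shift ^^ j) ` vars q"
proof (induction j)
  case (Suc j)
  have "vars (sigma ((sigma ^^ j) q)) \<subseteq> shift ` vars ((sigma ^^ j) q)"
    unfolding sigma_eq by (rule vars_rename)
  also have "\<dots> \<subseteq> shift ` (shift ^^ j) ` vars q"
    by (rule image_mono) (rule Suc.IH)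
  finally show ?case by (simp add: image_comp comp_def)
qed simp

lemma deg_in_sigma_iterate: "deg_in ((shift ^^ j) v) ((sigma ^^ j) q) \<le> deg_in v q"
proof (induction j)
  case (Suc j)
  have "deg_in (shift ((shift ^^ j) v)) (sigma ((sigma ^^ j) q)) \<le> deg_in ((shift ^^ j) v) ((sigma ^^ j) q)"
    unfolding sigma_eq by (rule deg_in_rename_le) (rule inj_on_subset[OF inj_shift subset_UNIV])
  then show ?case using Suc.IH by simp
qed simp

lemma sigma_iterate_hom:
  "(sigma ^^ j) (x + y) = (sigma ^^ j) x + (sigma ^^ j) y"
  "(sigma ^^ j) (x - y) = (sigma ^^ j) x - (sigma ^^ j) y"
  "(sigma ^^ j) (x * y) = (sigma ^^ j) x * (sigma ^^ j) y"
  "(sigma ^^ j) (x ^ n) = (sigma ^^ j) x ^ n"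
  "(sigma ^^ j) (pvar v) = pvar ((shift ^^ j) v)"
  by (induction j)
     (simp_all add: sigma_eq psubst_add psubst_diff psubst_mult psubst_power psubst_pvar)

lemma sigma_iterate_z_equation:
  "(sigma ^^ j) (z_equation Q b) = (sigma ^^ j) Q * pvar (Z j) - (sigma ^^ j) b"
  by (simp add: z_equation_def sigma_iterate_hom shift_iterate_Z)

lemma sigma_iterate_w_equation:
  "(sigma ^^ j) (w_equation Q \<mu> a e k) =
     (sigma ^^ j) Q * pvar (W k (Suc j)) ^ \<mu> k - (sigma ^^ j) (a k + e k)"
  by (simp add: w_equation_def sigma_iterate_hom shift_iterate_W)


section \<open>The polynomial data of a radical-rational dynamical system\<close>

text \<open>Substitution respects cross-multiplication, so the value is the same for all representations whose
  denominator survives.\<close>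

lemma ratsubst_Fract:
  fixes h :: "'v::linorder \<Rightarrow> ('u::linorder, 'a::idom) mpoly"
  assumes "den \<noteq> 0" "psubst h den \<noteq> 0"
  shows "ratsubst h (Fract num den) = Fract (psubst h num) (psubst h den)"
  unfolding ratsubst_def
proof (rule the_equality)
  show "\<exists>num' den'. den' \<noteq> 0 \<and> psubst h den' \<noteq> 0 \<and> Fract num den = Fract num' den' \<and>
      Fract (psubst h num) (psubst h den) = Fract (psubst h num') (psubst h den')"
    using assms by blast
next
  fix r
  assume "\<exists>num' den'. den' \<noteq> 0 \<and> psubst h den' \<noteq> 0 \<and> Fract num den = Fract num' den' \<and>
      r = Fract (psubst h num') (psubst h den')"
  then obtain num' den' where r: "den' \<noteq> 0" "psubst h den' \<noteq> 0" "Fract num den = Fract num' den'"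
      "r = Fract (psubst h num') (psubst h den')" by blast
  then have "num * den' = num' * den" using assms by (simp add: eq_fract)
  then have "psubst h num * psubst h den' = psubst h num' * psubst h den"
    by (metis psubst_mult)
  then show "r = Fract (psubst h num) (psubst h den)"
    using r assms by (simp add: eq_fract)
qed

lemma Mdim_Suc: "Mdim p (Suc i) = Mdim p i + dorder (p (Suc i))"
  by (simp add: Mdim_def)

lemma Mdim_mono: "i \<le> i' \<Longrightarrow> Mdim p i \<le> Mdim p i'"
  unfolding Mdim_def by (rule sum_mono2) auto

text \<open>Beyond the order, \<open>wvar\<close> goes on to \<open>\<sigma>\<^sup>2, \<sigma>\<^sup>3, \<dots>\<close> of the last \<open>w\<close> of its block, so \<open>to_w\<close> is an embedding of
  the whole ring of difference polynomials in one indeterminate, and nonzero polynomials stay nonzero.\<close>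

lemma inj_wvar: "inj (wvar p i)"
  by (auto simp: inj_on_def wvar_def split: if_splits)

lemma wvar_dorder: "wvar p i (dorder (p i)) = W (Mdim p i) 1"
  by (simp add: wvar_def)

abbreviation base_vars :: "nat \<Rightarrow> svar set" where
  "base_vars M \<equiv> {W k 0 | k. k \<in> {1..M}}"

lemma to_w_in_base_vars:
  assumes "i \<in> {1..N}" "vars q \<subseteq> {..<dorder (p i)}"
  shows "to_w p i q \<in> polys_in (base_vars (Mdim p N))"
proof -
  have "Mdim p (i - 1) + dorder (p i) \<le> Mdim p N"
    using Mdim_Suc[of p "i - 1"] Mdim_mono[of i N p] assms(1) by simp
  then have "wvar p i ` {..<dorder (p i)} \<subseteq> base_vars (Mdim p N)"
    by (auto simp: wvar_def)
  then show ?thesis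
    using vars_rename[of "wvar p i" q] assms(2) unfolding polys_in_def to_w_def by blast
qed

lemma to_w_in_base_vars_insert:
  assumes "i \<in> {1..N}" "vars q \<subseteq> {..dorder (p i)}"
  shows "to_w p i q \<in> polys_in (insert (W (Mdim p i) 1) (base_vars (Mdim p N)))"
proof -
  have "Mdim p (i - 1) + dorder (p i) \<le> Mdim p N"
    using Mdim_Suc[of p "i - 1"] Mdim_mono[of i N p] assms(1) by simp
  then have "wvar p i ` {..dorder (p i)} \<subseteq> insert (W (Mdim p i) 1) (base_vars (Mdim p N))"
    by (auto simp: wvar_def)
  then show ?thesis
    using vars_rename[of "wvar p i" q] assms(2) unfolding polys_in_def to_w_def by blast
qed

lemma deg_in_to_w: "deg_in (W (Mdim p i) 1) (to_w p i q) \<le> deg_in (dorder (p i)) q"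
  unfolding to_w_def wvar_dorder[symmetric]
  by (rule deg_in_rename_le) (rule inj_on_subset[OF inj_wvar subset_UNIV])

lemma lead_var_eqI:
  assumes "strict_linear_order_on A r" "v \<in> vars q" "\<And>u. u \<in> vars q \<Longrightarrow> u \<noteq> v \<Longrightarrow> (u, v) \<in> r"
  shows "lead_var r q = v"
  unfolding lead_var_def
proof (rule the_equality)
  show "v \<in> vars q \<and> (\<forall>u\<in>vars q. u \<noteq> v \<longrightarrow> (u, v) \<in> r)" using assms by blast
next
  fix w assume w: "w \<in> vars q \<and> (\<forall>u\<in>vars q. u \<noteq> w \<longrightarrow> (u, w) \<in> r)"
  show "w = v"
  proof (rule ccontr)
    assume "w \<noteq> v"
    then have "(w, v) \<in> r" "(v, w) \<in> r" using w assms by auto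
    then show False
      using assms(1) by (auto simp: strict_linear_order_on_def irrefl_def dest: transD)
  qed
qed

lemma vars_sigma_iterate_base:
  assumes "q \<in> polys_in (base_vars M)"
  shows "vars ((sigma ^^ j) q) \<subseteq> {W k j | k. k \<in> {1..M}}"
proof -
  have "vars ((sigma ^^ j) q) \<subseteq> (shift ^^ j) ` base_vars M"
    using vars_sigma_iterate[of j q] assms unfolding polys_in_def by blast
  then show ?thesis by (fastforce simp: shift_iterate_W)
qed

context
  fixes N :: nat and p :: "nat \<Rightarrow> 'k::field dpoly" and f :: "(nat, 'k) mpoly fract"
    and Q b :: "'k spoly" and \<mu> :: "nat \<Rightarrow> nat" and a e :: "nat \<Rightarrow> 'k spoly"
  assumes N: "N \<ge> 1"
    and p: "\<forall>i\<in>{1..N}. irreducible (p i) \<and> dorder (p i) \<ge> 1"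
    and f: "f \<in> ratfuns_in {1..N}"
    and rat_data: "radical_rational_data N p f Q \<mu> a e b"
begin

lemma Q_nonzero: "Q \<noteq> 0"
  and Q_in_base_vars: "Q \<in> polys_in (base_vars (Mdim p N))"
  using rat_data by (auto simp: radical_rational_data_def)

lemma tail_of_chain_equation:
  assumes "k \<in> {1..Mdim p N}" "k \<notin> Mdim p ` {1..N}"
  shows "\<mu> k = 1" "a k + e k = Q * pvar (W (k + 1) 0)" "k + 1 \<in> {1..Mdim p N}"
proof -
  have data: "\<mu> k = 1" "Fract (a k) Q = Fract (pvar (W (k + 1) 0)) 1" "Fract (e k) Q = Fract 0 1"
    using rat_data assms by (auto simp: radical_rational_data_def Zero_fract_def)
  show "\<mu> k = 1" by fact
  show "a k + e k = Q * pvar (W (k + 1) 0)"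
    using data(2,3) Q_nonzero by (simp add: eq_fract mult.commute)
  have "k \<noteq> Mdim p N" using assms(2) N by auto
  then show "k + 1 \<in> {1..Mdim p N}" using assms(1) by auto
qed

text \<open>Clearing denominators in \<open>A + E = - p\<^sub>i\<^sub>,\<^sub>1 / \<I>\<close>. The parts \<open>A\<close> and \<open>E\<close> enter the equation only through
  their sum, so the tail of \<open>p\<^sub>i\<close> is kept whole.\<close>

lemma tail_of_radical_equation:
  assumes "i \<in> {1..N}"
  shows "to_w p i (initial (p i)) * (a (Mdim p i) + e (Mdim p i)) = - (Q * to_w p i (dtail (p i)))"
    and "to_w p i (initial (p i)) \<noteq> 0"
proof -
  have "vars (p i) \<noteq> {}" using p assms irreducible_has_variables by blast
  then have "initial (p i) \<noteq> 0" by (rule initial_nonzero)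
  then show nz: "to_w p i (initial (p i)) \<noteq> 0"
    unfolding to_w_def by (intro rename_nonzero) (rule inj_on_subset[OF inj_wvar subset_UNIV])
  have "Fract (a (Mdim p i)) Q = - Fract (to_w p i (dtail_free (p i))) (to_w p i (initial (p i)))"
    "Fract (e (Mdim p i)) Q = - Fract (to_w p i (dtail_involving (p i))) (to_w p i (initial (p i)))"
    using rat_data assms by (auto simp: radical_rational_data_def)
  then have "a (Mdim p i) * to_w p i (initial (p i)) = - to_w p i (dtail_free (p i)) * Q"
    "e (Mdim p i) * to_w p i (initial (p i)) = - to_w p i (dtail_involving (p i)) * Q"
    using nz Q_nonzero by (simp_all add: eq_fract)
  moreover have "to_w p i (dtail (p i)) = to_w p i (dtail_free (p i)) + to_w p i (dtail_involving (p i))"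
    unfolding to_w_def by (simp add: dtail_involving_def flip: psubst_add)
  ultimately show "to_w p i (initial (p i)) * (a (Mdim p i) + e (Mdim p i)) = - (Q * to_w p i (dtail (p i)))"
    by (simp add: algebra_simps)
qed

text \<open>For \<open>k = M\<^sub>i\<close>, the initial and \<open>Q\<close> are free of \<open>\<sigma>(w\<^sub>k)\<close>, so cancelling the initial in a domain does not change the
  degree in \<open>\<sigma>(w\<^sub>k)\<close> and adds no variables, and the degree of the tail of \<open>p\<^sub>i\<close> is less than \<open>m\<^sub>i\<close>.
  For other \<open>k\<close>, \<open>\<sigma>(w\<^sub>k)\<close> is absent altogether.\<close>

lemma equation_tail:
  assumes "k \<in> {1..Mdim p N}"
  shows "a k + e k \<in> polys_in (insert (W k 1) (base_vars (Mdim p N)))"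
    and "deg_in (W k 1) (a k + e k) < \<mu> k"
proof -
  have "a k + e k \<in> polys_in (insert (W k 1) (base_vars (Mdim p N))) \<and> deg_in (W k 1) (a k + e k) < \<mu> k"
  proof (cases "k \<in> Mdim p ` {1..N}")
    case False
    note tail = tail_of_chain_equation[OF assms False]
    have "a k + e k \<in> polys_in (base_vars (Mdim p N))"
      unfolding tail(2) using tail(3) by (intro polys_in_mult Q_in_base_vars) auto
    then show ?thesis
      using tail(1) polys_in_mono[of "base_vars (Mdim p N)" "insert (W k 1) (base_vars (Mdim p N))"]
      by (auto simp: polys_in_iff)
  next
    case True
    then obtain i where i: "i \<in> {1..N}" "k = Mdim p i" by blast
    let ?I = "to_w p i (initial (p i))"
    have vars: "vars (p i) \<noteq> {}" using p i irreducible_has_variables by blast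
    note tail = tail_of_radical_equation[OF i(1), folded i(2)]
    have I: "?I \<in> polys_in (base_vars (Mdim p N))"
      by (rule to_w_in_base_vars) (fact i(1), rule vars_initial[OF vars])
    have "to_w p i (dtail (p i)) \<in> polys_in (insert (W k 1) (base_vars (Mdim p N)))"
      unfolding i(2) by (rule to_w_in_base_vars_insert) (fact i(1), rule vars_dtail[OF vars])
    then have "?I * (a k + e k) \<in> polys_in (insert (W k 1) (base_vars (Mdim p N)))"
      unfolding tail(1) polys_in_uminus
      using polys_in_mono[OF subset_insertI Q_in_base_vars] by (intro polys_in_mult)
    then have 1: "a k + e k \<in> polys_in (insert (W k 1) (base_vars (Mdim p N)))"
      by (rule polys_in_factor[OF tail(2)])
    have "\<mu> k = ddegree (p i)"
      using rat_data i by (auto simp: radical_rational_data_def)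
    moreover have "deg_in (W k 1) (a k + e k) < ddegree (p i)"
    proof (cases "a k + e k = 0")
      case True
      then show ?thesis using ddegree_pos[OF vars] by simp
    next
      case False
      then have "deg_in (W k 1) (a k + e k) \<le> deg_in (W k 1) (?I * (a k + e k))"
        using deg_in_mult[OF tail(2) False] by simp
      also have "\<dots> \<le> deg_in (W k 1) Q + deg_in (W k 1) (to_w p i (dtail (p i)))"
        unfolding tail(1) deg_in_uminus by (rule deg_in_mult_le)
      also have "deg_in (W k 1) Q = 0"
        using Q_in_base_vars by (auto simp: polys_in_iff)
      also have "0 + deg_in (W k 1) (to_w p i (dtail (p i))) \<le> deg_in (dorder (p i)) (dtail (p i))"
        unfolding i(2) by (simp only: add_0 deg_in_to_w)
      also have "\<dots> < ddegree (p i)" by (rule deg_in_dtail[OF vars])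
      finally show ?thesis .
    qed
    ultimately show ?thesis using 1 by simp
  qed
  then show "a k + e k \<in> polys_in (insert (W k 1) (base_vars (Mdim p N)))"
    "deg_in (W k 1) (a k + e k) < \<mu> k" by auto
qed

text \<open>The variables substituted into \<open>f\<close> are distinct because all orders are positive, so the denominator
  of \<open>f\<close> does not vanish and can be cancelled.\<close>

lemma b_in_base_vars: "b \<in> polys_in (base_vars (Mdim p N))"
proof -
  define \<rho> where "\<rho> i = W (Mdim p (i - 1) + 1) 0" for i
  obtain num den where nd: "f = Fract num den" "num \<in> polys_in {1..N}" "den \<in> polys_in {1..N}" "den \<noteq> 0"
    using f unfolding ratfuns_in_def by auto
  have Mdim_step: "Mdim p (i - 1) < Mdim p i" if "i \<in> {1..N}" for i
    using Mdim_Suc[of p "i - 1"] p that by force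
  have "inj_on \<rho> {1..N}"
  proof (rule linorder_inj_onI)
    fix i j assume "i < j" "i \<in> {1..N}" "j \<in> {1..N}"
    then have "Mdim p (i - 1) < Mdim p (j - 1)"
      using Mdim_step[of i] Mdim_mono[of i "j - 1" p] by (simp add: Suc_leI less_le_trans)
    then show "\<rho> i \<noteq> \<rho> j" by (simp add: \<rho>_def)
  qed auto
  then have nz: "psubst (\<lambda>i. pvar (\<rho> i)) den \<noteq> 0"
    using nd by (intro rename_nonzero) (auto simp: polys_in_def intro: inj_on_subset)
  have "Fract b Q = Fract (psubst (\<lambda>i. pvar (\<rho> i)) num) (psubst (\<lambda>i. pvar (\<rho> i)) den)"
    using rat_data nz nd by (simp add: radical_rational_data_def \<rho>_def ratsubst_Fract)
  then have eq: "psubst (\<lambda>i. pvar (\<rho> i)) den * b = psubst (\<lambda>i. pvar (\<rho> i)) num * Q"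
    using nz Q_nonzero by (simp add: eq_fract mult.commute)
  have "\<rho> ` {1..N} \<subseteq> base_vars (Mdim p N)"
  proof clarify
    fix i assume "i \<in> {1..N}"
    then show "\<exists>k. \<rho> i = W k 0 \<and> k \<in> {1..Mdim p N}"
      using Mdim_step[of i] Mdim_mono[of i N p] by (auto simp: \<rho>_def)
  qed
  then have "psubst (\<lambda>i. pvar (\<rho> i)) num \<in> polys_in (base_vars (Mdim p N))"
    using vars_rename[of \<rho> num] nd(2) unfolding polys_in_def by blast
  then have "psubst (\<lambda>i. pvar (\<rho> i)) den * b \<in> polys_in (base_vars (Mdim p N))"
    unfolding eq by (rule polys_in_mult) (rule Q_in_base_vars)
  then show ?thesis by (rule polys_in_factor[OF nz])
qed


section \<open>Triangularity\<close>

text \<open>The degree of \<open>Q \<sigma>(w\<^sub>k)\<^sup>\<mu>\<close> in \<open>\<sigma>(w\<^sub>k)\<close> exceeds that of the tail, so the two cannot cancel.\<close>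

lemma lead_var_w_equation:
  assumes "admissible_ordering (Mdim p N) r" "k \<in> {1..Mdim p N}"
  shows "lead_var r (w_equation Q \<mu> a e k) = W k 1" "W k 1 \<in> vars (w_equation Q \<mu> a e k)"
proof -
  have eq: "w_equation Q \<mu> a e k = Q * pvar (W k 1) ^ \<mu> k - (a k + e k)"
    by (simp add: w_equation_def)
  note tail = equation_tail[OF assms(2)]
  have "deg_in (W k 1) (Q * pvar (W k 1) ^ \<mu> k) = deg_in (W k 1) Q + \<mu> k"
    using Q_nonzero by (simp add: deg_in_mult deg_in_power deg_in_pvar)
  also have "Q * pvar (W k 1) ^ \<mu> k = w_equation Q \<mu> a e k + (a k + e k)"
    by (simp add: eq)
  finally have "\<mu> k \<le> deg_in (W k 1) (w_equation Q \<mu> a e k + (a k + e k))" by simp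
  also have "\<dots> \<le> max (deg_in (W k 1) (w_equation Q \<mu> a e k)) (deg_in (W k 1) (a k + e k))"
    by (rule deg_in_add_le)
  finally have "0 < deg_in (W k 1) (w_equation Q \<mu> a e k)"
    using tail(2) by (auto simp: le_max_iff_disj)
  then show 1: "W k 1 \<in> vars (w_equation Q \<mu> a e k)" by (simp add: in_vars_iff_deg_in)
  have "w_equation Q \<mu> a e k \<in> polys_in (insert (W k 1) (base_vars (Mdim p N)))"
    unfolding eq using tail(1) polys_in_mono[OF subset_insertI Q_in_base_vars]
    by (intro polys_in_diff polys_in_mult polys_in_power) auto
  then have "vars (w_equation Q \<mu> a e k) \<subseteq> insert (W k 1) (base_vars (Mdim p N))"
    by (simp add: polys_in_def)
  moreover have "(W i 0, W k 1) \<in> r" if "i \<in> {1..Mdim p N}" for i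
    using assms that by (fastforce simp: admissible_ordering_def)
  ultimately show "lead_var r (w_equation Q \<mu> a e k) = W k 1"
    using assms(1) 1 by (intro lead_var_eqI[of _ r]) (auto simp: admissible_ordering_def)
qed

lemma lead_var_z_equation:
  assumes "admissible_ordering (Mdim p N) r"
  shows "lead_var r (z_equation Q b) = Z 0" "Z 0 \<in> vars (z_equation Q b)"
proof -
  have "deg_in (Z 0) (Q * pvar (Z 0)) = deg_in (Z 0) Q + 1"
    using Q_nonzero by (simp add: deg_in_mult deg_in_pvar)
  also have "Q * pvar (Z 0) = z_equation Q b + b"
    by (simp add: z_equation_def)
  finally have "1 \<le> deg_in (Z 0) (z_equation Q b + b)" by simp
  also have "\<dots> \<le> max (deg_in (Z 0) (z_equation Q b)) (deg_in (Z 0) b)"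
    by (rule deg_in_add_le)
  also have "deg_in (Z 0) b = 0" using b_in_base_vars by (auto simp: polys_in_iff)
  finally show 1: "Z 0 \<in> vars (z_equation Q b)" by (simp add: in_vars_iff_deg_in)
  have "z_equation Q b \<in> polys_in (insert (Z 0) (base_vars (Mdim p N)))"
    unfolding z_equation_def
    using polys_in_mono[OF subset_insertI b_in_base_vars] polys_in_mono[OF subset_insertI Q_in_base_vars]
    by (intro polys_in_diff polys_in_mult) auto
  then have "vars (z_equation Q b) \<subseteq> insert (Z 0) (base_vars (Mdim p N))"
    by (simp add: polys_in_def)
  moreover have "(W i 0, Z 0) \<in> r" if "i \<in> {1..Mdim p N}" for i
    using assms that by (auto simp: admissible_ordering_def)
  ultimately show "lead_var r (z_equation Q b) = Z 0"
    using assms(1) 1 by (intro lead_var_eqI[of _ r]) (auto simp: admissible_ordering_def)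
qed

lemma triangular_equation_set:
  assumes "admissible_ordering (Mdim p N) r"
  shows "triangular r (equation_set (Mdim p N) Q \<mu> a e b)"
proof -
  note lead = lead_var_w_equation[OF assms] lead_var_z_equation[OF assms]
  have "vars q \<noteq> {}" if "q \<in> equation_set (Mdim p N) Q \<mu> a e b" for q
    using that lead(2,4) unfolding equation_set_def by blast
  moreover have "inj_on (lead_var r) (equation_set (Mdim p N) Q \<mu> a e b)"
    by (rule inj_onI) (auto simp: equation_set_def lead(1,3))
  ultimately show ?thesis by (simp add: triangular_def)
qed


section \<open>A relation between the outputs\<close>

lemma vars_sigma_iterate_tail:
  assumes "k \<in> {1..Mdim p N}"
  shows "vars ((sigma ^^ j) (a k + e k)) \<subseteq> insert (W k (Suc j)) {W k j | k. k \<in> {1..Mdim p N}}"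
proof -
  have "vars ((sigma ^^ j) (a k + e k)) \<subseteq> (shift ^^ j) ` insert (W k 1) (base_vars (Mdim p N))"
    using vars_sigma_iterate[of j "a k + e k"] equation_tail(1)[OF assms] unfolding polys_in_def by blast
  then show ?thesis by (fastforce simp: shift_iterate_W)
qed

text \<open>All variables of the truncation except \<open>w\<^sub>1, \<dots>, w\<^sub>M\<close> are eliminated: \<open>\<sigma>\<^sup>j(z)\<close> by \<open>\<sigma>\<^sup>j(Q z - b)\<close>, and
  \<open>\<sigma>\<^sup>j\<^sup>+\<^sup>1(w\<^sub>k)\<close> by the \<open>j\<close>-th shift of its equation. There remain \<open>M\<close> variables against \<open>M + 1\<close> outputs.\<close>

lemma output_relation:
  fixes M :: nat
  assumes M: "M = Mdim p N"
  shows "\<exists>q \<in> polys_in {Z j | j. j \<le> M}. q \<noteq> 0 \<and> q \<in> truncated_ideal M Q \<mu> a e b"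
proof -
  define V where "V = {W k j | k j. k \<in> {1..M} \<and> j \<le> M} \<union> {Z j | j. j \<le> M}"
  define X where "X = {W k (Suc j) | k j. k \<in> {1..M} \<and> j < M} \<union> {Z j | j. j \<le> M}"
  define Y where "Y = {Z j | j. j \<le> M}"
  define G where "G = {(sigma ^^ j) (w_equation Q \<mu> a e k) | k j. k \<in> {1..M} \<and> j < M} \<union>
              {(sigma ^^ j) (z_equation Q b) | j. j \<le> M}"
  define H where "H = {(sigma ^^ j) Q | j. j \<le> M}"
  define h where "h v = (case v of W k j \<Rightarrow> (sigma ^^ (j - 1)) Q | Z j \<Rightarrow> (sigma ^^ j) Q)" for v
  define t where "t v = (case v of W k j \<Rightarrow> (sigma ^^ (j - 1)) (a k + e k) | Z j \<Rightarrow> (sigma ^^ j) b)" for v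
  define \<nu> where "\<nu> v = (case v of W k j \<Rightarrow> \<mu> k | Z j \<Rightarrow> 1)" for v
  \<comment> \<open>The outputs go first, then the \<open>w\<close>'s from the highest shift down, as the multiplier and the tail of
    an equation involve, apart from the eliminated variable, lower shifts only.\<close>
  define rk where "rk v = (case v of W k j \<Rightarrow> M + 1 - j | Z j \<Rightarrow> 0)" for v
  have X_cases: "P v" if "v \<in> X" "\<And>k j. k \<in> {1..M} \<Longrightarrow> j < M \<Longrightarrow> P (W k (Suc j))"
    "\<And>j. j \<le> M \<Longrightarrow> P (Z j)" for P v
    using that unfolding X_def by blast
  have h_simps [simp]: "h (W k (Suc j)) = (sigma ^^ j) Q" "h (Z j) = (sigma ^^ j) Q" for k j
    by (simp_all add: h_def)
  have t_simps [simp]: "t (W k (Suc j)) = (sigma ^^ j) (a k + e k)" "t (Z j) = (sigma ^^ j) b" for k j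
    by (simp_all add: t_def)
  have vars_Q: "vars ((sigma ^^ j) Q) \<subseteq> {W k j | k. k \<in> {1..M}}" for j
    using vars_sigma_iterate_base[OF Q_in_base_vars] by (simp add: M)
  have vars_b: "vars ((sigma ^^ j) b) \<subseteq> {W k j | k. k \<in> {1..M}}" for j
    using vars_sigma_iterate_base[OF b_in_base_vars] by (simp add: M)
  have vars_t: "vars ((sigma ^^ j) (a k + e k)) \<subseteq> insert (W k (Suc j)) {W k j | k. k \<in> {1..M}}"
    if "k \<in> {1..M}" for k j
    using vars_sigma_iterate_tail[of k j] that by (simp add: M)

  have "V = (\<lambda>(k, j). W k j) ` ({1..M} \<times> {..M}) \<union> Z ` {..M}"
    unfolding V_def by auto
  then have "finite V" by simp
  moreover have "X \<subseteq> V" "Y \<subseteq> V" unfolding X_def Y_def V_def by auto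
  moreover have "card (V - X) < card Y"
  proof -
    have "V - X \<subseteq> (\<lambda>k. W k 0) ` {1..M}"
    proof
      fix v assume v: "v \<in> V - X"
      then obtain k j where "v = W k j" "k \<in> {1..M}" "j \<le> M" unfolding V_def X_def by auto
      then show "v \<in> (\<lambda>k. W k 0) ` {1..M}"
        using v unfolding X_def by (cases j) auto
    qed
    then have "card (V - X) \<le> M"
      using surj_card_le[of "{1..M}" "V - X"] by simp
    moreover have "Y = Z ` {..M}" unfolding Y_def by auto
    then have "card Y = M + 1" by (simp add: card_image inj_on_def)
    ultimately show ?thesis by simp
  qed
  moreover have "h v * pvar v ^ \<nu> v - t v \<in> ideal_in (polys_in V) G" if "v \<in> X" for v
  proof (rule generator_in_ideal_in, rule X_cases[OF that])
    show "h (W k (Suc j)) * pvar (W k (Suc j)) ^ \<nu> (W k (Suc j)) - t (W k (Suc j)) \<in> G"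
      if "k \<in> {1..M}" "j < M" for k j
      unfolding G_def using that
      by (auto simp: \<nu>_def sigma_iterate_w_equation[symmetric])
    show "h (Z j) * pvar (Z j) ^ \<nu> (Z j) - t (Z j) \<in> G" if "j \<le> M" for j
      unfolding G_def using that
      by (auto simp: \<nu>_def sigma_iterate_z_equation[symmetric])
  qed
  moreover have "h v \<in> H" if "v \<in> X" for v
    by (rule X_cases[OF that]) (auto simp: H_def intro: less_imp_le)
  moreover have "h v \<in> polys_in V" if "v \<in> X" for v
    by (rule X_cases[OF that]) (use vars_Q in \<open>fastforce simp: polys_in_def V_def\<close>)+
  moreover have "v \<notin> vars (h v)" if "v \<in> X" for v
    by (rule X_cases[OF that]) (use vars_Q in fastforce)+
  moreover have "t v \<in> polys_in V" if "v \<in> X" for v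
  proof (rule X_cases[OF that])
    show "t (W k (Suc j)) \<in> polys_in V" if "k \<in> {1..M}" "j < M" for k j
    proof -
      have "insert (W k (Suc j)) {W k j | k. k \<in> {1..M}} \<subseteq> V"
        unfolding V_def using that by auto
      then show ?thesis using vars_t[OF that(1), of j] unfolding polys_in_def t_simps by blast
    qed
    show "t (Z j) \<in> polys_in V" if "j \<le> M" for j
    proof -
      have "{W k j | k. k \<in> {1..M}} \<subseteq> V" unfolding V_def using that by auto
      then show ?thesis using vars_b[of j] unfolding polys_in_def t_simps by blast
    qed
  qed
  moreover have "deg_in v (t v) < \<nu> v" if "v \<in> X" for v
  proof (rule X_cases[OF that])
    show "deg_in (W k (Suc j)) (t (W k (Suc j))) < \<nu> (W k (Suc j))" if "k \<in> {1..M}" for k j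
    proof -
      have "deg_in (W k (Suc j)) ((sigma ^^ j) (a k + e k)) \<le> deg_in (W k 1) (a k + e k)"
        using deg_in_sigma_iterate[of j "W k 1" "a k + e k"] by (simp add: shift_iterate_W)
      then show ?thesis using equation_tail(2)[of k] that by (simp add: \<nu>_def M)
    qed
    show "deg_in (Z j) (t (Z j)) < \<nu> (Z j)" for j
      using vars_b[of j] deg_in_eq_0_iff[of "Z j" "(sigma ^^ j) b"] by (auto simp: \<nu>_def)
  qed
  moreover have "rk v < rk u"
    if "v \<in> X" "u \<in> X" "u \<in> vars (h v) \<union> vars (t v)" "u \<noteq> v" for v u
  proof -
    have "u \<in> vars (h v) \<union> vars (t v) \<longrightarrow> u \<noteq> v \<longrightarrow> rk v < rk u"
    proof (rule X_cases[OF that(1)])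
      show "u \<in> vars (h (W k (Suc j))) \<union> vars (t (W k (Suc j))) \<longrightarrow> u \<noteq> W k (Suc j) \<longrightarrow>
          rk (W k (Suc j)) < rk u" if "k \<in> {1..M}" "j < M" for k j
        using vars_Q[of j] vars_t[OF that(1), of j] that(2) by (auto simp: rk_def)
      show "u \<in> vars (h (Z j)) \<union> vars (t (Z j)) \<longrightarrow> u \<noteq> Z j \<longrightarrow> rk (Z j) < rk u" if "j \<le> M" for j
        using vars_Q[of j] vars_b[of j] that by (auto simp: rk_def)
    qed
    then show ?thesis using that by blast
  qed
  ultimately have "\<exists>q \<in> polys_in Y. q \<noteq> 0 \<and> q \<in> saturation_in (polys_in V) (ideal_in (polys_in V) G) H"
    by (rule elimination_dependence[of V X Y h \<nu> t G H rk])
  moreover have "truncated_ideal M Q \<mu> a e b = saturation_in (polys_in V) (ideal_in (polys_in V) G) H"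
    by (simp add: truncated_ideal_def V_def G_def H_def Let_def)
  ultimately show ?thesis by (simp only: Y_def)
qed

end

theorem theorem3p2:
  fixes N M :: nat
    and p :: "nat \<Rightarrow> 'k::{alg_closed_field, field_char_0} dpoly"
    and f :: "(nat, 'k) mpoly fract"
    and Q b :: "'k spoly"
    and \<mu> :: "nat \<Rightarrow> nat"
    and a e :: "nat \<Rightarrow> 'k spoly"
    and r :: "(svar \<times> svar) set"
  assumes "N \<ge> 1"
    and "\<forall>i\<in>{1..N}. irreducible (p i) \<and> dorder (p i) \<ge> 1"
    and "f \<in> ratfuns_in {1..N}"
    and "M = Mdim p N"
    and "radical_rational_data N p f Q \<mu> a e b"
    and "admissible_ordering M r"
  shows "triangular r (equation_set M Q \<mu> a e b) \<and>
         truncated_ideal M Q \<mu> a e b \<inter> polys_in {Z j | j. True} \<noteq> {0}"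
proof
  show "triangular r (equation_set M Q \<mu> a e b)"
    using triangular_equation_set[OF assms(1,2,3,5)] assms(4,6) by simp
  obtain q where "q \<in> polys_in {Z j | j. j \<le> M}" "q \<noteq> 0" "q \<in> truncated_ideal M Q \<mu> a e b"
    using output_relation[OF assms(1,2,3,5,4)] by blast
  moreover have "q \<in> polys_in {Z j | j. True}"
    using \<open>q \<in> polys_in {Z j | j. j \<le> M}\<close> by (rule polys_in_mono[rotated]) blast
  ultimately show "truncated_ideal M Q \<mu> a e b \<inter> polys_in {Z j | j. True} \<noteq> {0}"
    by blast
qed

end
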